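(* Let $n\ge 1$, let $g$ be an $n$-dimensional standard Gaussian vector, and let $F:\mathbb{R}^n\to\mathbb{R}$ be a convex function such that $\mathbb{E}\, e^{\lambda F(g)}<\infty$ for all $\lambda>0$. Then the function $\Phi:\mathbb{R}\to\mathbb{R}$ defined by $$\Phi(\lambda)=\frac{1}{\lambda}\ln \mathbb{E}\, e^{\lambda F(g)}\quad\text{for }\lambda\neq 0,\qquad \Phi(0)=\mathbb{E}F(g),$$ is convex on $\mathbb{R}$.
   Context: A standard Gaussian vector in $\mathbb{R}^n$ has i.i.d. $N(0,1)$ coordinates. The function $\Phi$ is finite everywhere: for $\lambda>0$ by assumption, and for $\lambda<0$ because a convex function is bounded below by an affine function. *)

theory Defs
  imports "HOL-Probability.Probability"
begin

context prob_space
begin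

definition standard_gaussian_vector :: "('a \<Rightarrow> real ^ 'n) \<Rightarrow> bool" where
  "standard_gaussian_vector g \<longleftrightarrow>
     indep_vars (\<lambda>_. borel) (\<lambda>i \<omega>. g \<omega> $ i) UNIV \<and>
     (\<forall>i. distributed M lborel (\<lambda>\<omega>. g \<omega> $ i) std_normal_density)"

(* Expectations are Bochner integrals, which are 0 for non-integrable functions. For X = F(g)
   with F convex and exp (l * F(g)) integrable for all l > 0, every integrand below is integrable
   (a convex F is bounded below by an affine function), so that default value never occurs. *)
definition normalized_cgf :: "('a \<Rightarrow> real) \<Rightarrow> real \<Rightarrow> real" where
  "normalized_cgf X l =
     (if l = 0 then expectation X else (1 / l) * ln (expectation (\<lambda>\<omega>. exp (l * X \<omega>))))"

end

end

theory Submission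
  imports Defs
begin

text \<open>
  For a convex Lipschitz function the claim is proved one coordinate at a time: if \<open>G(x, l)\<close> is
  jointly convex, then so is \<open>(x, l) \<mapsto> (1/l) ln E exp (l G(x + \<gamma> e, l))\<close> for a standard
  normal variable \<open>\<gamma>\<close> and a unit vector \<open>e\<close>. By the Gibbs variational principle,
  \<open>ln E exp (l G(\<gamma>))\<close> is the maximum of \<open>l E G(S \<gamma>) - E ((S \<gamma>)^2/2 - \<gamma>^2/2 - ln S'(\<gamma>))\<close> over increasing
  maps \<open>S\<close>, attained at the transport of the Gaussian measure to its tilt by \<open>exp (l G)\<close>. As \<open>G\<close> is
  convex, this optimal map is expanding for \<open>l > 0\<close> and contracting for \<open>l < 0\<close>.

  For \<open>l > 0\<close> write the optimal map as \<open>S(z) = z + l v(z)\<close> and test the endpoints \<open>m = l0, l1\<close> with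
  \<open>z + m v(z)\<close>; the entropy cost divided by \<open>m\<close> is concave in \<open>m\<close> because \<open>ln (1 + m v') / m\<close> is convex
  for \<open>v' \<ge> 0\<close>. For \<open>l < 0\<close> test the middle point with the convex combination of the two optimal maps;
  after a Gaussian integration by parts this amounts to convexity of \<open>(D, m) \<mapsto> (D - 1 - ln D) / m\<close>
  for \<open>0 < D \<le> 1\<close> and \<open>m > 0\<close>.

  General convex functions are limits of their Lipschitz envelopes. The two half-lines are glued at 0,
  where the function is differentiable (with derivative half the variance).
\<close>

section \<open>Two convex functions of one variable\<close>

text \<open>The signs need different arguments because division by a negative parameter turns the
  maximum of the variational principle into a minimum. For \<open>l > 0\<close> there is a supremum,
  which preserves convexity: for a fixed field \<open>v\<close> with \<open>v' >= 0\<close> the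
  tested expression divided by \<open>m\<close> is convex in \<open>m\<close> pointwise, since
  \<open>z * v\<close> is constant and \<open>m * v^2 / 2\<close> linear in \<open>m\<close>. For
  \<open>l < 0\<close> there is an infimum, which preserves convexity only if the expression is
  jointly convex in map and parameter. With \<open>u = S z - z\<close> the cost divided by
  \<open>m\<close> consists of \<open>z * u / m\<close>, \<open>u^2 / (2 * m)\<close> and
  \<open>- ln D / m\<close>; the first is not jointly convex, and integration by parts trades it for
  \<open>(D - 1) / m\<close>. Expansion and contraction are essential:
  \<open>ln (1 + m * a) / m\<close> is not convex for \<open>a < 0\<close>, nor is
  \<open>(D - 1 - ln D) / m\<close> jointly convex for \<open>D > 1\<close>. For Lipschitz functions
  the optimal map moves points by a bounded distance, so the costs grow at most linearly and
  boundary terms vanish. Integrating out a coordinate keeps the Lipschitz constant.\<close>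

lemma convex_on_ln_one_plus_over:
  fixes a :: real
  assumes a: "a \<ge> 0"
  shows "convex_on {0<..} (\<lambda>l. ln (1 + l * a) / l)"
proof -
  \<comment> \<open>With \<open>x = l * a\<close>, the difference of the two sides is
    \<open>l ^ 3\<close> times the second derivative computed below. It vanishes at 0 and is
    increasing.\<close>
  have key: "(2 * x + 3 * x\<^sup>2) / (1 + x)\<^sup>2 \<le> 2 * ln (1 + x)" if "x \<ge> 0" for x :: real
  proof -
    let ?f = "\<lambda>x::real. 2 * ln (1 + x) - (2 * x + 3 * x\<^sup>2) / (1 + x)\<^sup>2"
    have "?f 0 \<le> ?f x"
    proof (rule DERIV_nonneg_imp_nondecreasing[OF that])
      fix y :: real assume y: "0 \<le> y" "y \<le> x"
      have "DERIV ?f y :> 2 * y\<^sup>2 / (1 + y) ^ 3"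
      proof -
        have "DERIV ?f y :> 2 / (1 + y) - ((2 + 6 * y) * (1 + y)\<^sup>2 - (2 * y + 3 * y\<^sup>2) * (2 * (1 + y)))
            / ((1 + y)\<^sup>2)\<^sup>2" (is "DERIV _ _ :> ?d")
          using y by (auto intro!: derivative_eq_intros simp: power2_eq_square)
        also have "?d = 2 * y\<^sup>2 / (1 + y) ^ 3"
        proof -
          obtain q where q: "y = q - 1" "q > 0" using y by (metis add.commute add_diff_cancel_left' add_pos_nonneg zero_less_one)
          show ?thesis unfolding q(1) using q(2)
            by (simp add: field_simps power2_eq_square power3_eq_cube)
        qed
        finally show ?thesis .
      qed
      thus "\<exists>d. DERIV ?f y :> d \<and> 0 \<le> d"
        using y by (intro exI[of _ "2 * y\<^sup>2 / (1 + y) ^ 3"]) simp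
    qed
    thus ?thesis by simp
  qed
  show ?thesis
  proof (rule f''_ge0_imp_convex)
    show "convex ({0<..} :: real set)" by simp
    fix l :: real assume "l \<in> {0<..}"
    hence l: "l > 0" by simp
    define q where "q = 1 + l * a"
    have q: "q > 0" using l a by (simp add: q_def add_pos_nonneg)
    have D0: "DERIV (\<lambda>l. ln (1 + l * a)) l :> a / q"
      using q unfolding q_def by (auto intro!: derivative_eq_intros)
    show "DERIV (\<lambda>l. ln (1 + l * a) / l) l :> a / (l * (1 + l * a)) - ln (1 + l * a) / l\<^sup>2"
    proof -
      from DERIV_divide[OF D0 DERIV_ident] l
      have "DERIV (\<lambda>l. ln (1 + l * a) / l) l :> (a / q * l - ln q * 1) / (l * l)"
        by (simp add: q_def)
      moreover have "(a / q * l - ln q * 1) / (l * l) = a / (l * q) - ln q / l\<^sup>2"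
        using l q by (simp add: field_simps power2_eq_square)
      ultimately show ?thesis by (simp add: q_def)
    qed
    have D1: "DERIV (\<lambda>l. l * (1 + l * a)) l :> q + l * a"
      unfolding q_def by (auto intro!: derivative_eq_intros)
    have D2: "DERIV (\<lambda>l. l\<^sup>2) l :> 2 * l"
      by (auto intro!: derivative_eq_intros)
    have "DERIV (\<lambda>l. a / (l * (1 + l * a)) - ln (1 + l * a) / l\<^sup>2) l :>
        (0 * (l * q) - a * (q + l * a)) / (l * q * (l * q)) -
        (a / q * l\<^sup>2 - ln q * (2 * l)) / (l\<^sup>2 * l\<^sup>2)" (is "DERIV _ _ :> ?d")
      using DERIV_diff[OF DERIV_divide[OF DERIV_const[of a] D1] DERIV_divide[OF D0 D2]] l q
      by (simp add: q_def)
    also have "?d = (2 * ln q - (2 * (l * a) + 3 * (l * a)\<^sup>2) / q\<^sup>2) / l ^ 3"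
    proof -
      have a: "a = (q - 1) / l" using l by (simp add: q_def)
      show ?thesis unfolding a using l q
        by (simp add: field_simps power2_eq_square power3_eq_cube)
    qed
    finally show "DERIV (\<lambda>l. a / (l * (1 + l * a)) - ln (1 + l * a) / l\<^sup>2) l :>
        (2 * ln (1 + l * a) - (2 * (l * a) + 3 * (l * a)\<^sup>2) / (1 + l * a)\<^sup>2) / l ^ 3"
      by (simp add: q_def)
    show "0 \<le> (2 * ln (1 + l * a) - (2 * (l * a) + 3 * (l * a)\<^sup>2) / (1 + l * a)\<^sup>2) / l ^ 3"
      using key[of "l * a"] l a by auto
  qed
qed

text \<open>The difference of the sides vanishes at 1 and has derivative
  \<open>- (1 - y)^2 / y\<close>. The inequality therefore reverses beyond 1, which is why the maps
  must contract.\<close>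

lemma sub_one_minus_ln_ge:
  fixes x :: real
  assumes x: "0 < x" "x \<le> 1"
  shows "(1 - x)\<^sup>2 / 2 \<le> x - 1 - ln x"
proof -
  let ?f = "\<lambda>x::real. x - 1 - ln x - (1 - x)\<^sup>2 / 2"
  have "?f x \<ge> ?f 1"
  proof (rule DERIV_nonpos_imp_nonincreasing[OF x(2)])
    fix y :: real assume y: "x \<le> y" "y \<le> 1"
    have "DERIV ?f y :> - (1 - y)\<^sup>2 / y"
      using x y by (auto intro!: derivative_eq_intros simp: field_simps power2_eq_square)
    thus "\<exists>d. DERIV ?f y :> d \<and> d \<le> 0" using x y by (intro exI conjI) auto
  qed
  thus ?thesis by simp
qed

text \<open>For a positive smooth \<open>p\<close>, joint convexity of \<open>p x / m\<close>
  amounts to \<open>2 * p * p'' >= p'^2\<close>, that is, to convexity of the root of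
  \<open>p\<close>. Here this is the preceding inequality. The endpoint 1 is left out because the
  root vanishes there and the derivative formulas divide by it.\<close>

lemma convex_on_sqrt_sub_one_minus_ln:
  "convex_on {0<..<1} (\<lambda>x::real. sqrt (x - 1 - ln x))"
proof -
  let ?p = "\<lambda>x::real. x - 1 - ln x"
  have pos: "?p x > 0" if "x \<in> {0<..<1}" for x
    using sub_one_minus_ln_ge[of x] that by (smt (verit) divide_pos_pos greaterThanLessThan_iff zero_less_power)
  show ?thesis
  proof (rule f''_ge0_imp_convex)
    show "convex ({0<..<1} :: real set)" by simp
    fix x :: real assume x: "x \<in> {0<..<1}"
    note p = pos[OF x]
    show "DERIV (\<lambda>x. sqrt (?p x)) x :> (1 - 1 / x) / (2 * sqrt (?p x))"
      using x p by (auto intro!: derivative_eq_intros simp: field_simps)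
    show "DERIV (\<lambda>x. (1 - 1 / x) / (2 * sqrt (?p x))) x :>
        (2 * ?p x - (1 - x)\<^sup>2) / (4 * x\<^sup>2 * sqrt (?p x) ^ 3)"
    proof -
      define s where "s = sqrt (?p x)"
      have s: "s > 0" "?p x = s\<^sup>2" using p by (auto simp: s_def)
      have "DERIV (\<lambda>x. (1 - 1 / x) / (2 * sqrt (?p x))) x :>
         (1 / x\<^sup>2 * (2 * s) - (1 - 1/x) * (2 * ((1 - 1 / x) / (2 * s)))) / (2 * s)\<^sup>2"
        (is "DERIV _ _ :> ?d")
        unfolding s_def
        using x p by (auto intro!: derivative_eq_intros simp: field_simps power2_eq_square)
      also have "?d = (2 * s\<^sup>2 - (1 - x)\<^sup>2) / (4 * x\<^sup>2 * s ^ 3)"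
        using x s(1) by (simp add: field_simps power2_eq_square power3_eq_cube)
      finally show ?thesis unfolding s(2) using s(1) by simp
    qed
    show "0 \<le> (2 * ?p x - (1 - x)\<^sup>2) / (4 * x\<^sup>2 * sqrt (?p x) ^ 3)"
      using sub_one_minus_ln_ge[of x] x p by auto
  qed
qed

text \<open>\<open>p / m\<close> is the composition of \<open>a^2 / m\<close>, jointly convex by
  Cauchy-Schwarz and increasing in \<open>a >= 0\<close>, with the convex function
  \<open>a = sqrt p\<close>.\<close>

lemma sub_one_minus_ln_perspective_convex:
  fixes x0 x1 m0 m1 s :: real
  assumes x: "0 < x0" "x0 \<le> 1" "0 < x1" "x1 \<le> 1" and m: "m0 > 0" "m1 > 0" and s: "0 < s" "s < 1"
  defines "m \<equiv> (1 - s) * m0 + s * m1" and "x \<equiv> (1 - s) * x0 + s * x1"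
  shows "(x - 1 - ln x) / m \<le> (1 - s) * ((x0 - 1 - ln x0) / m0) + s * ((x1 - 1 - ln x1) / m1)"
proof -
  define p where "p = (\<lambda>x::real. x - 1 - ln x)"
  have p0: "p y \<ge> 0" if "0 < y" for y using ln_le_minus_one[of y] that by (simp add: p_def)
  have mpos: "m > 0" using m s by (simp add: m_def add_pos_pos)
  have strict: "p ((1 - s) * y0 + s * y1) / m \<le> (1 - s) * (p y0 / m0) + s * (p y1 / m1)"
    if y: "0 < y0" "y0 < 1" "0 < y1" "y1 < 1" for y0 y1
  proof -
    let ?y = "(1 - s) * y0 + s * y1"
    have ypos: "?y > 0" using y s by (simp add: add_pos_pos)
    have "sqrt (p ?y) \<le> (1 - s) * sqrt (p y0) + s * sqrt (p y1)" (is "_ \<le> ?r")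
      using convex_onD[OF convex_on_sqrt_sub_one_minus_ln, of s y0 y1] y s
      by (simp add: p_def algebra_simps)
    hence "sqrt (p ?y) ^ 2 \<le> ?r ^ 2" by (intro power_mono) (use p0 ypos in auto)
    hence A: "p ?y \<le> ?r ^ 2" using p0 ypos by simp
    define a where "a = sqrt (p y0)"
    define b where "b = sqrt (p y1)"
    have ab: "p y0 = a\<^sup>2" "p y1 = b\<^sup>2" using p0 y by (auto simp: a_def b_def)
    have "((1 - s) * a + s * b)\<^sup>2 \<le> ((1 - s) * (a\<^sup>2 / m0) + s * (b\<^sup>2 / m1)) * m"
    proof -
      have "((1 - s) * (a\<^sup>2 / m0) + s * (b\<^sup>2 / m1)) * m - ((1 - s) * a + s * b)\<^sup>2
         = s * (1 - s) * (a * m1 - b * m0)\<^sup>2 / (m0 * m1)"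
        using m by (simp add: m_def field_simps power2_eq_square)
      also have "\<dots> \<ge> 0" using m s by simp
      finally show ?thesis by simp
    qed
    with A have "p ?y \<le> ((1 - s) * (a\<^sup>2 / m0) + s * (b\<^sup>2 / m1)) * m" by (simp add: a_def b_def)
    thus ?thesis using mpos by (simp add: ab divide_le_eq)
  qed
  \<comment> \<open>Points equal to 1 are reached by scaling both points with \<open>c < 1\<close>
    and letting \<open>c\<close> tend to 1.\<close>
  have "p x / m \<le> (1 - s) * (p x0 / m0) + s * (p x1 / m1)"
  proof (rule tendsto_le[OF trivial_limit_at_left_real])
    have xpos: "x > 0" using x s by (simp add: x_def add_pos_pos)
    show "((\<lambda>c. p ((1 - s) * (c * x0) + s * (c * x1)) / m) \<longlongrightarrow> p x / m) (at_left 1)"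
      unfolding x_def p_def using xpos[unfolded x_def]
      by (auto intro!: tendsto_eq_intros simp: m_def x_def) (use mpos m_def in simp)+
    show "((\<lambda>c. (1 - s) * (p (c * x0) / m0) + s * (p (c * x1) / m1)) \<longlongrightarrow>
        (1 - s) * (p x0 / m0) + s * (p x1 / m1)) (at_left 1)"
      unfolding p_def using x m by (auto intro!: tendsto_eq_intros)
    have "eventually (\<lambda>c::real. c \<in> {0<..<1}) (at_left 1)"
      by (rule eventually_at_leftI[of 0]) auto
    thus "eventually (\<lambda>c. p ((1 - s) * (c * x0) + s * (c * x1)) / m \<le>
         (1 - s) * (p (c * x0) / m0) + s * (p (c * x1) / m1)) (at_left 1)"
    proof eventually_elim
      case (elim c)
      have "c * x0 < 1" "c * x1 < 1" using elim x by (smt (verit) greaterThanLessThan_iff mult_left_le)+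
      thus ?case using elim x by (intro strict) auto
    qed
  qed
  thus ?thesis by (simp add: p_def)
qed

section \<open>Increasing transport between densities on the line\<close>

lemma set_lebesgue_integral_atMost_DERIV:
  fixes p :: "real \<Rightarrow> real"
  assumes int: "integrable lborel p" and cont: "continuous_on UNIV p"
  shows "((\<lambda>y. LINT x:{..y}|lborel. p x) has_real_derivative p y) (at y)"
proof -
  have int': "set_integrable lborel A p" if "A \<in> sets borel" for A
    using int that by (simp add: set_integrable_def integrable_mult_indicator del: real_scaleR_def)
  have "((\<lambda>u. LBINT x=y..u. p x) has_vector_derivative p y) (at y within {y - 1..y + 1})"
    by (rule interval_integral_FTC2) (auto intro: continuous_on_subset[OF cont])
  hence D: "((\<lambda>u. LBINT x=y..u. p x) has_real_derivative p y) (at y)"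
    by (simp add: has_real_derivative_iff_has_vector_derivative at_within_Icc_at)
  have eq: "(LINT x:{..u}|lborel. p x) = (LINT x:{..y}|lborel. p x) + (LBINT x=y..u. p x)" for u
  proof (cases "y \<le> u")
    case True
    have "(LINT x:{..u}|lborel. p x) = (LINT x:{..y} \<union> {y<..u}|lborel. p x)"
      using True by (intro arg_cong[where f = "\<lambda>A. set_lebesgue_integral lborel A p"]) auto
    also have "\<dots> = (LINT x:{..y}|lborel. p x) + (LINT x:{y<..u}|lborel. p x)"
      by (intro set_integral_Un int') auto
    finally show ?thesis using True by (simp add: interval_integral_Ioc)
  next
    case False
    have "(LINT x:{..y}|lborel. p x) = (LINT x:{..u} \<union> {u<..y}|lborel. p x)"
      using False by (intro arg_cong[where f = "\<lambda>A. set_lebesgue_integral lborel A p"]) auto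
    also have "\<dots> = (LINT x:{..u}|lborel. p x) + (LINT x:{u<..y}|lborel. p x)"
      by (intro set_integral_Un int') auto
    finally show ?thesis using False
      by (subst interval_integral_endpoints_reverse) (simp add: interval_integral_Ioc)
  qed
  have "((\<lambda>u. (LINT x:{..y}|lborel. p x) + (LBINT x=y..u. p x)) has_real_derivative p y) (at y)"
    using D by (auto intro!: derivative_eq_intros)
  thus ?thesis by (rule ssubst[OF ext[OF eq]])
qed

lemma integral_split_at:
  fixes p :: "real \<Rightarrow> real"
  assumes int: "integrable lborel p"
  shows "(\<integral>x. p x \<partial>lborel) = (LINT x:{..y}|lborel. p x) + (LINT x:{y<..}|lborel. p x)"
proof -
  have int': "set_integrable lborel A p" if "A \<in> sets borel" for A
    using int that by (simp add: set_integrable_def integrable_mult_indicator del: real_scaleR_def)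
  have "(\<integral>x. p x \<partial>lborel) = (LINT x:{..y} \<union> {y<..}|lborel. p x)"
    by (simp add: set_lebesgue_integral_def) (intro Bochner_Integration.integral_cong, auto split: split_indicator)
  also have "\<dots> = (LINT x:{..y}|lborel. p x) + (LINT x:{y<..}|lborel. p x)"
    by (intro set_integral_Un int') auto
  finally show ?thesis .
qed

lemma set_lebesgue_integral_atMost_at_top:
  fixes p :: "real \<Rightarrow> real"
  assumes int: "integrable lborel p"
  shows "((\<lambda>y. LINT x:{..y}|lborel. p x) \<longlongrightarrow> (\<integral>x. p x \<partial>lborel)) at_top"
  unfolding set_lebesgue_integral_def
proof (rule integral_dominated_convergence_at_top[where w = "\<lambda>x. \<bar>p x\<bar>"])
  show "AE x in lborel. ((\<lambda>i. indicat_real {..i} x *\<^sub>R p x) \<longlongrightarrow> p x) at_top"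
  proof (intro AE_I2 tendsto_eventually)
    fix x show "eventually (\<lambda>i. indicat_real {..i} x *\<^sub>R p x = p x) at_top"
      using eventually_ge_at_top[of x] by eventually_elim auto
  qed
qed (use int in \<open>auto simp: abs_mult split: split_indicator\<close>)

lemma set_lebesgue_integral_atMost_at_bot:
  fixes p :: "real \<Rightarrow> real"
  assumes int: "integrable lborel p"
  shows "((\<lambda>y. LINT x:{..y}|lborel. p x) \<longlongrightarrow> 0) at_bot"
proof -
  have "((\<lambda>y. \<integral>x. indicat_real {..- y} x *\<^sub>R p x \<partial>lborel) \<longlongrightarrow> (\<integral>x. 0 \<partial>(lborel :: real measure))) at_top"
  proof (rule integral_dominated_convergence_at_top[where w = "\<lambda>x. \<bar>p x\<bar>"])
    show "AE x in lborel. ((\<lambda>i. indicat_real {..- i} x *\<^sub>R p x) \<longlongrightarrow> 0) at_top"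
    proof (intro AE_I2 tendsto_eventually)
      fix x show "eventually (\<lambda>i. indicat_real {..- i} x *\<^sub>R p x = 0) at_top"
        using eventually_gt_at_top[of "-x"] by eventually_elim auto
    qed
  qed (use int in \<open>auto simp: abs_mult split: split_indicator\<close>)
  thus ?thesis by (simp add: filterlim_at_bot_mirror set_lebesgue_integral_def)
qed

text \<open>\<open>S\<close> is the quantile function of \<open>q\<close> composed with the
  distribution function of \<open>p\<close>. Positivity of \<open>q\<close> makes the distribution
  function \<open>Q\<close> strictly increasing with a differentiable inverse.\<close>

lemma monotone_transport:
  fixes p q :: "real \<Rightarrow> real"
  assumes p: "integrable lborel p" "continuous_on UNIV p" "\<And>x. p x > 0" "(\<integral>x. p x \<partial>lborel) = 1"
    and q: "integrable lborel q" "continuous_on UNIV q" "\<And>x. q x > 0" "(\<integral>x. q x \<partial>lborel) = 1"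
  obtains S where
    "\<And>z. (LINT x:{..S z}|lborel. q x) = (LINT x:{..z}|lborel. p x)"
    "\<And>z. (S has_real_derivative p z / q (S z)) (at z)"
proof -
  define P where "P = (\<lambda>y. LINT x:{..y}|lborel. p x)"
  define Q where "Q = (\<lambda>y. LINT x:{..y}|lborel. q x)"
  have DP: "(P has_real_derivative p y) (at y)" and DQ: "(Q has_real_derivative q y) (at y)" for y
    unfolding P_def Q_def using set_lebesgue_integral_atMost_DERIV p q by blast+
  have mono: "P x < P y" "Q x < Q y" if "x < y" for x y
    using DERIV_pos_imp_increasing[OF that] DP DQ p(3) q(3) by blast+
  have lim: "(P \<longlongrightarrow> 1) at_top" "(P \<longlongrightarrow> 0) at_bot" "(Q \<longlongrightarrow> 1) at_top" "(Q \<longlongrightarrow> 0) at_bot"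
    using set_lebesgue_integral_atMost_at_top[OF p(1)] set_lebesgue_integral_atMost_at_bot[OF p(1)]
      set_lebesgue_integral_atMost_at_top[OF q(1)] set_lebesgue_integral_atMost_at_bot[OF q(1)]
    by (simp_all add: P_def Q_def p(4) q(4))
  \<comment> \<open>The inequalities must be strict, so that \<open>P z\<close> lies among the
    values attained by \<open>Q\<close>.\<close>
  have range: "0 < P y" "P y < 1" for y
  proof -
    have "P (y + 1) \<le> 1"
    proof (rule tendsto_lowerbound[OF lim(1) _ trivial_limit_at_top_linorder])
      show "\<forall>\<^sub>F x in at_top. P (y + 1) \<le> P x"
        using eventually_gt_at_top[of "y + 1"] by eventually_elim (rule less_imp_le[OF mono(1)])
    qed
    thus "P y < 1" using mono(1)[of y "y + 1"] by simp
    have "P (y - 1) \<ge> 0"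
    proof (rule tendsto_upperbound[OF lim(2) _ trivial_limit_at_bot_linorder])
      show "\<forall>\<^sub>F x in at_bot. P x \<le> P (y - 1)"
        using eventually_le_at_bot[of "y - 2"] by eventually_elim (rule less_imp_le[OF mono(1)], simp)
    qed
    thus "0 < P y" using mono(1)[of "y - 1" y] by simp
  qed
  have "\<exists>s. Q s = P z" for z
  proof -
    obtain a where a: "Q a < P z"
      using order_tendstoD(2)[OF lim(4) range(1)[of z]] eventually_happens'[OF trivial_limit_at_bot_linorder] by blast
    obtain b where b: "Q b > P z"
      using order_tendstoD(1)[OF lim(3) range(2)[of z]] eventually_happens'[OF trivial_limit_at_top_linorder] by blast
    have "a \<le> b" using a b mono(2)[of b a] by linarith
    moreover have "\<forall>x. a \<le> x \<and> x \<le> b \<longrightarrow> isCont Q x" using DERIV_isCont[OF DQ] by blast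
    ultimately show ?thesis using IVT[of Q a "P z" b] a b by (meson less_imp_le)
  qed
  then obtain S where S: "Q (S z) = P z" for z by metis
  define R where "R = (\<lambda>y. THE x. Q x = y)"
  have inj: "Q x = Q y \<longleftrightarrow> x = y" for x y using mono(2) by (metis less_irrefl linorder_neqE)
  have R: "R (Q x) = x" for x unfolding R_def by (simp add: inj)
  have DR: "(R has_real_derivative 1 / q x) (at (Q x))" for x
  proof -
    have "(R has_derivative (\<lambda>h. h / q x)) (at (Q x))"
    proof (rule has_derivative_inverse_strong[where f = Q and S = UNIV and x = x])
      show "continuous_on UNIV Q" using DERIV_isCont[OF DQ] by (simp add: continuous_at_imp_continuous_on)
      show "(Q has_derivative (*) (q x)) (at x)" using DQ[of x] by (simp add: has_field_derivative_def)
      show "(*) (q x) \<circ> (\<lambda>h. h / q x) = id" using q(3)[of x] by (auto simp: fun_eq_iff)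
    qed (auto simp: R)
    moreover have "(\<lambda>h. h / q x) = (*) (1 / q x)" by (simp add: fun_eq_iff)
    ultimately show ?thesis unfolding has_field_derivative_def by simp
  qed
  have SR: "S = (\<lambda>z. R (P z))"
  proof
    show "S z = R (P z)" for z using R[of "S z"] by (simp only: S)
  qed
  have "(S has_real_derivative p z / q (S z)) (at z)" for z
  proof -
    have "((\<lambda>z. R (P z)) has_real_derivative 1 / q (S z) * p z) (at z)"
      by (rule DERIV_chain2[OF DR[of "S z", unfolded S] DP])
    hence "(S has_real_derivative 1 / q (S z) * p z) (at z)" by (simp only: SR[symmetric])
    thus ?thesis by simp
  qed
  thus ?thesis using that S unfolding P_def Q_def by blast
qed

section \<open>Transport of the Gaussian measure to a log-Lipschitz tilt\<close>

text \<open>Applied to differences of two densities on half-lines: equal masses force a point where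
  a chosen one of them is at least the other.\<close>

lemma set_lebesgue_integral_zero_imp_nonneg_point:
  fixes f :: "real \<Rightarrow> real"
  assumes int: "integrable lborel f" and A: "A \<in> sets borel" "\<not> A \<in> null_sets lborel"
    and zero: "(LINT x:A|lborel. f x) = 0"
  shows "\<exists>x\<in>A. f x \<ge> 0"
proof (rule ccontr)
  assume "\<not> ?thesis"
  hence neg: "f x < 0" if "x \<in> A" for x using that by force
  have int': "integrable lborel (\<lambda>x. - (indicator A x *\<^sub>R f x))"
    using integrable_mult_indicator[OF _ int, of A] A by simp
  have "(\<integral>x. - (indicator A x *\<^sub>R f x) \<partial>lborel) = 0"
    using zero by (simp add: set_lebesgue_integral_def)
  hence "AE x in lborel. - (indicator A x *\<^sub>R f x) = 0"
    by (subst (asm) integral_nonneg_eq_0_iff_AE[OF int'])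
      (use neg in \<open>auto split: split_indicator intro: less_imp_le\<close>)
  hence "AE x in lborel. x \<notin> A"
    by eventually_elim (use neg in \<open>force split: split_indicator_asm\<close>)
  hence "A \<in> null_sets lborel" using A by (simp add: AE_iff_null_sets)
  thus False using A by simp
qed

lemma Iic_Ioi_not_null: "\<not> {..z::real} \<in> null_sets lborel" "\<not> {z<..} \<in> null_sets lborel"
proof -
  show "\<not> {..z} \<in> null_sets lborel"
  proof
    assume "{..z} \<in> null_sets lborel"
    hence "{z - 1..z} \<in> null_sets lborel" by (rule null_sets_subset) auto
    thus False by (simp add: null_sets_def)
  qed
  show "\<not> {z<..} \<in> null_sets lborel"
  proof
    assume "{z<..} \<in> null_sets lborel"
    hence "{z<..z+1} \<in> null_sets lborel" by (rule null_sets_subset) auto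
    thus False by (simp add: null_sets_def)
  qed
qed

text \<open>Since the total masses agree, a comparison on the right half-line is the opposite
  comparison on the left one. If the ratio of the densities is monotone, one of the alternatives
  holds at every \<open>z\<close>.\<close>

lemma single_crossing_lower_mass_le:
  fixes p q :: "real \<Rightarrow> real"
  assumes p: "integrable lborel p" and q: "integrable lborel q"
    and eq: "(\<integral>x. p x \<partial>lborel) = (\<integral>x. q x \<partial>lborel)"
    and cross: "(\<forall>x\<le>z. p x \<le> q x) \<or> (\<forall>x>z. q x \<le> p x)"
  shows "(LINT x:{..z}|lborel. p x) \<le> (LINT x:{..z}|lborel. q x)"
proof -
  have int': "set_integrable lborel A f" if "A \<in> sets borel" "integrable lborel f" for A and f :: "real \<Rightarrow> real"
    using that by (simp add: set_integrable_def integrable_mult_indicator del: real_scaleR_def)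
  show ?thesis using cross
  proof
    assume "\<forall>x\<le>z. p x \<le> q x"
    thus ?thesis by (intro set_integral_mono int' p q) auto
  next
    assume "\<forall>x>z. q x \<le> p x"
    hence "(LINT x:{z<..}|lborel. q x) \<le> (LINT x:{z<..}|lborel. p x)"
      by (intro set_integral_mono int' p q) auto
    thus ?thesis using integral_split_at[OF p, of z] integral_split_at[OF q, of z] eq by simp
  qed
qed

lemma convex_on_nonpos_between:
  fixes k :: "real \<Rightarrow> real"
  assumes k: "convex_on UNIV k" and "k x \<le> 0" "k y \<le> 0" "x \<le> z" "z \<le> y"
  shows "k z \<le> 0"
proof (cases "x = y")
  case False
  hence xy: "x < y" using assms by simp
  define t where "t = (z - x) / (y - x)"
  have "t * (y - x) = z - x" using xy by (simp add: t_def)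
  hence t: "0 \<le> t" "t \<le> 1" "z = (1 - t) * x + t * y"
    using xy assms by (simp_all add: t_def[symmetric] algebra_simps) (simp_all add: t_def)
  have "k z \<le> (1 - t) * k x + t * k y" using convex_onD[OF k, of t x y] t by simp
  also have "\<dots> \<le> 0" using t assms by (simp add: add_nonpos_nonpos mult_nonneg_nonpos)
  finally show ?thesis .
qed (use assms in auto)

lemma std_normal_density_shift:
  "std_normal_density (x + a) = exp (- a * x - a\<^sup>2 / 2) * std_normal_density x"
proof -
  have "- (x + a)\<^sup>2 / 2 = (- a * x - a\<^sup>2 / 2) + (- x\<^sup>2 / 2)"
    by (simp add: power2_eq_square algebra_simps add_divide_distrib diff_divide_distrib)
  thus ?thesis by (simp only: std_normal_density_def exp_add mult_ac)
qed

lemma integrable_exp_abs_std_normal: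
  "integrable lborel (\<lambda>x. exp (K * \<bar>x\<bar>) * std_normal_density x)"
proof -
  \<comment> \<open>Completing the square: the tilted density is a constant times the density
    translated by \<open>a\<close>.\<close>
  have *: "integrable lborel (\<lambda>x. exp (a * x) * std_normal_density x)" for a
  proof -
    have "integrable lborel (\<lambda>x. exp (a\<^sup>2 / 2) * std_normal_density (- a + 1 * x))"
      by (intro integrable_mult_right lborel_integrable_real_affine) auto
    also have "(\<lambda>x. exp (a\<^sup>2 / 2) * std_normal_density (- a + 1 * x)) = (\<lambda>x. exp (a * x) * std_normal_density x)"
      using std_normal_density_shift[of _ "- a"] by (auto simp: exp_add[symmetric] exp_diff fun_eq_iff)
    finally show ?thesis .
  qed
  show ?thesis
  proof (rule Bochner_Integration.integrable_bound[OF Bochner_Integration.integrable_add[OF *[of K] *[of "-K"]]])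
    have "exp (K * \<bar>x\<bar>) \<le> exp (K * x) + exp (- K * x)" for x by (cases "x \<ge> 0") auto
    hence "exp (K * \<bar>x\<bar>) * std_normal_density x
        \<le> exp (K * x) * std_normal_density x + exp (- K * x) * std_normal_density x" for x
      by (metis distrib_right mult_right_mono normal_density_nonneg)
    thus "AE x in lborel. norm (exp (K * \<bar>x\<bar>) * std_normal_density x)
        \<le> norm (exp (K * x) * std_normal_density x + exp (- K * x) * std_normal_density x)"
      by (intro AE_I2) (simp add: abs_mult)
  qed auto
qed

lemma std_normal_density_pos: "std_normal_density x > 0"
  by (rule normal_density_pos) simp

lemma continuous_on_std_normal_density: "continuous_on A std_normal_density"
  unfolding normal_density_def by (intro continuous_intros) auto

lemma lipschitz_on_abs_le:
  fixes h :: "real \<Rightarrow> real"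
  assumes "K-lipschitz_on UNIV h"
  shows "\<bar>h x\<bar> \<le> \<bar>h 0\<bar> + K * \<bar>x\<bar>"
  using lipschitz_onD[OF assms, of x 0] by (simp add: dist_real_def)

lemma lipschitz_on_borel_measurable:
  fixes h :: "'a::metric_space \<Rightarrow> real"
  assumes "K-lipschitz_on UNIV h"
  shows "h \<in> borel_measurable borel"
  using lipschitz_on_continuous_on[OF assms] by (rule borel_measurable_continuous_onI)

lemma integrable_exp_lipschitz_std_normal:
  assumes h: "K-lipschitz_on UNIV h"
  shows "integrable lborel (\<lambda>x. exp (h x) * std_normal_density x)"
proof (rule Bochner_Integration.integrable_bound)
  show "integrable lborel (\<lambda>x. exp \<bar>h 0\<bar> * (exp (K * \<bar>x\<bar>) * std_normal_density x))"
    by (intro integrable_mult_right integrable_exp_abs_std_normal)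
  note [measurable] = lipschitz_on_borel_measurable[OF h]
  show "(\<lambda>x. exp (h x) * std_normal_density x) \<in> borel_measurable lborel" by measurable
  have "exp (h x) \<le> exp \<bar>h 0\<bar> * exp (K * \<bar>x\<bar>)" for x
    using lipschitz_on_abs_le[OF h, of x] by (simp add: exp_add[symmetric])
  thus "AE x in lborel. norm (exp (h x) * std_normal_density x)
      \<le> norm (exp \<bar>h 0\<bar> * (exp (K * \<bar>x\<bar>) * std_normal_density x))"
    by (intro AE_I2) (simp add: abs_mult mult.assoc[symmetric] mult_right_mono)
qed

lemma integral_exp_std_normal_pos:
  assumes "integrable lborel (\<lambda>x. exp (h x) * std_normal_density x)"
  shows "(\<integral>x. exp (h x) * std_normal_density x \<partial>lborel) > 0"
proof (rule ccontr)
  assume "\<not> ?thesis"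
  moreover have "(\<integral>x. exp (h x) * std_normal_density x \<partial>lborel) \<ge> 0"
    by (intro integral_nonneg_AE) auto
  ultimately have "(\<integral>x. - (exp (h x) * std_normal_density x) \<partial>lborel) = 0" by simp
  from set_lebesgue_integral_zero_imp_nonneg_point[of "\<lambda>x. - (exp (h x) * std_normal_density x)" UNIV] this assms
  obtain x where "- (exp (h x) * std_normal_density x) \<ge> 0"
    by (auto simp: set_lebesgue_integral_def null_sets_def)
  thus False using std_normal_density_pos[of x] by (simp add: mult_le_0_iff not_less)
qed

text \<open>In one dimension, the rearrangement of the Gaussian measure into \<open>exp h\<close> times it expands
  if \<open>h\<close> is convex and contracts if \<open>h\<close> is concave. Translating the target by \<open>a = S z - z\<close>
  gives it the same mass to the left of \<open>z\<close> as the Gaussian, so the log-convex (log-concave)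
  density ratio \<open>r\<close> takes values on the same side of 1 left and right of \<open>z\<close>.\<close>

lemma gaussian_transport:
  fixes h :: "real \<Rightarrow> real"
  assumes h: "K-lipschitz_on UNIV h"
  defines "c \<equiv> \<integral>x. exp (h x) * std_normal_density x \<partial>lborel"
  obtains S D where
    "\<And>z. (S has_real_derivative D z) (at z)" "continuous_on UNIV D" "\<And>z. D z > 0"
    "\<And>z. \<bar>S z - z\<bar> \<le> K"
    "\<And>z. ln c = h (S z) + z\<^sup>2 / 2 - (S z)\<^sup>2 / 2 + ln (D z)"
    "convex_on UNIV h \<Longrightarrow> (\<And>z. D z \<ge> 1)" "concave_on UNIV h \<Longrightarrow> (\<And>z. D z \<le> 1)"
proof -
  let ?\<phi> = std_normal_density
  define q where "q = (\<lambda>x. exp (h x) * ?\<phi> x / c)"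
  have int: "integrable lborel (\<lambda>x. exp (h x) * ?\<phi> x)"
    by (rule integrable_exp_lipschitz_std_normal[OF h])
  have c: "c > 0" unfolding c_def by (rule integral_exp_std_normal_pos[OF int])
  have conth: "continuous_on UNIV h" by (rule lipschitz_on_continuous_on[OF h])
  have qint: "integrable lborel q" unfolding q_def using int by simp
  have q1: "(\<integral>x. q x \<partial>lborel) = 1" using c by (simp add: q_def c_def)
  have qcont: "continuous_on UNIV q"
    unfolding q_def by (intro continuous_intros conth continuous_on_std_normal_density) (use c in auto)
  have qpos: "q x > 0" for x using c std_normal_density_pos by (simp add: q_def)
  have qne: "q x \<noteq> 0" for x using qpos[of x] by simp
  obtain S where S: "\<And>z. (LINT x:{..S z}|lborel. q x) = (LINT x:{..z}|lborel. ?\<phi> x)"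
    "\<And>z. (S has_real_derivative ?\<phi> z / q (S z)) (at z)"
    using monotone_transport[of ?\<phi> q] qint q1 qcont qpos std_normal_density_pos continuous_on_std_normal_density
    by auto
  define D where "D = (\<lambda>z. ?\<phi> z / q (S z))"
  have contS: "continuous_on UNIV S" using DERIV_isCont[OF S(2)] by (simp add: continuous_at_imp_continuous_on)
  have Dpos: "D z > 0" for z unfolding D_def using qpos std_normal_density_pos by simp
  \<comment> \<open>The logarithm of the ratio of the translated target to the Gaussian. The
    quadratic exponents cancel up to a term affine in \<open>t\<close>, so \<open>r a\<close>
    inherits convexity or concavity from \<open>h\<close>.\<close>
  define r where "r = (\<lambda>a t. h (t + a) - a * t - a\<^sup>2 / 2 - ln c)"
  have r: "q (t + a) = exp (r a t) * ?\<phi> t" for a t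
  proof -
    have "r a t = h (t + a) + (- a * t - a\<^sup>2 / 2) - ln c" by (simp add: r_def)
    thus ?thesis using c by (simp only: q_def std_normal_density_shift exp_diff exp_add) simp
  qed
  have qaint: "integrable lborel (\<lambda>t. q (t + a))" for a
    using lborel_integrable_real_affine[OF qint, of 1 a] by (simp add: add.commute)
  have qa1: "(\<integral>t. q (t + a) \<partial>lborel) = 1" for a
    using lborel_integral_real_affine[of 1 q a] q1 by (simp add: add.commute)
  have shift: "(LINT x:{..z + a}|lborel. q x) = (LINT t:{..z}|lborel. q (t + a))" for z a
    using lborel_integral_real_affine[of 1 "\<lambda>x. indicator {..z + a} x *\<^sub>R q x" a]
    by (simp add: set_lebesgue_integral_def add.commute indicator_def)
  have Qmono: "x < y \<Longrightarrow> (LINT x:{..x}|lborel. q x) < (LINT x:{..y}|lborel. q x)" for x y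
    using DERIV_pos_imp_increasing[of x y "\<lambda>y. (LINT x:{..y}|lborel. q x)"]
      set_lebesgue_integral_atMost_DERIV[OF qint qcont] qpos by blast
  have hK: "\<bar>h x - h y\<bar> \<le> K * \<bar>x - y\<bar>" for x y
    using lipschitz_onD[OF h, of x y] by (simp add: dist_real_def)
  \<comment> \<open>The slopes of \<open>h\<close> are at most \<open>K\<close>, so translation by
    \<open>K\<close> makes the ratio antitone in \<open>t\<close>. Its sign at \<open>z\<close>
    decides which alternative of \<open>single_crossing_lower_mass_le\<close> applies.\<close>
  have up: "S z \<le> z + K" for z
  proof -
    have anti: "r K t' \<le> r K t" if "t \<le> t'" for t t'
      using hK[of "t' + K" "t + K"] that by (simp add: r_def algebra_simps)
    have "(\<forall>x\<le>z. ?\<phi> x \<le> q (x + K)) \<or> (\<forall>x>z. q (x + K) \<le> ?\<phi> x)"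
    proof (cases "r K z \<ge> 0")
      case True
      hence "\<forall>x\<le>z. r K x \<ge> 0" using anti by force
      thus ?thesis unfolding r using std_normal_density_pos by simp
    next
      case False
      hence "\<forall>x>z. r K x \<le> 0" using anti by (smt (verit))
      thus ?thesis unfolding r using std_normal_density_pos by simp
    qed
    hence "(LINT x:{..z}|lborel. ?\<phi> x) \<le> (LINT x:{..z}|lborel. q (x + K))"
      by (intro single_crossing_lower_mass_le qaint) (auto simp: qa1)
    hence "\<not> z + K < S z" using Qmono[of "z + K" "S z"] by (auto simp: S(1) shift)
    thus ?thesis by simp
  qed
  have low: "z - K \<le> S z" for z
  proof -
    have mono: "r (-K) t \<le> r (-K) t'" if "t \<le> t'" for t t'
      using hK[of "t' + -K" "t + -K"] that by (simp add: r_def algebra_simps)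
    have "(\<forall>x\<le>z. q (x + -K) \<le> ?\<phi> x) \<or> (\<forall>x>z. ?\<phi> x \<le> q (x + -K))"
    proof (cases "r (-K) z \<le> 0")
      case True
      hence "\<forall>x\<le>z. r (-K) x \<le> 0" using mono by force
      thus ?thesis unfolding r using std_normal_density_pos by simp
    next
      case False
      hence "\<forall>x>z. r (-K) x \<ge> 0" using mono by (smt (verit))
      thus ?thesis unfolding r using std_normal_density_pos by simp
    qed
    hence "(LINT x:{..z}|lborel. q (x + -K)) \<le> (LINT x:{..z}|lborel. ?\<phi> x)"
      by (intro single_crossing_lower_mass_le qaint) (auto simp: qa1[of "-K", simplified])
    hence "\<not> S z < z + -K" using Qmono[of "S z" "z + -K"] by (simp only: S(1) shift) linarith
    thus ?thesis by simp
  qed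
  have ratio: "r (S z - z) z = - ln (D z)" for z
  proof -
    have "q (S z) = exp (r (S z - z) z) * ?\<phi> z" using r[of z "S z - z"] by simp
    hence "D z = exp (- r (S z - z) z)"
      using std_normal_density_pos[of z] by (simp add: D_def exp_minus field_simps)
    thus ?thesis by simp
  qed
  \<comment> \<open>After translation by \<open>S z - z\<close> the target has the Gaussian mass on
    both half-lines at \<open>z\<close>, so the difference of the densities integrates to 0 on each.
    The factor \<open>s\<close> treats the convex case (1) and the concave case (-1)
    together.\<close>
  have cross: "(\<exists>x\<le>z. s * r (S z - z) x \<le> 0) \<and> (\<exists>x>z. s * r (S z - z) x \<le> 0)" if s: "s = 1 \<or> s = -1" for z s
  proof -
    let ?f = "\<lambda>t. s * (?\<phi> t - q (t + (S z - z)))"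
    have fint: "integrable lborel ?f" using qaint by simp
    have f: "?f t \<ge> 0 \<longleftrightarrow> s * r (S z - z) t \<le> 0" for t
      using std_normal_density_pos[of t] s unfolding r by auto
    have int': "set_integrable lborel A f" if "A \<in> sets borel" "integrable lborel f" for A and f :: "real \<Rightarrow> real"
      using that by (simp add: set_integrable_def integrable_mult_indicator del: real_scaleR_def)
    have z1: "(LINT t:{..z}|lborel. ?f t) = 0"
      using S(1)[of z] shift[of z "S z - z"] by (simp add: set_integral_diff int' qaint)
    have "(\<integral>t. ?f t \<partial>lborel) = 0" by (simp add: qaint qa1)
    hence z2: "(LINT t:{z<..}|lborel. ?f t) = 0" using integral_split_at[OF fint, of z] z1 by linarith
    from set_lebesgue_integral_zero_imp_nonneg_point[OF fint _ _ z1]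
      set_lebesgue_integral_zero_imp_nonneg_point[OF fint _ _ z2]
    show ?thesis unfolding f using Iic_Ioi_not_null by auto
  qed
  have convr: "convex_on UNIV (r a)" if hc: "convex_on UNIV h" for a
  proof (rule convex_onI)
    fix t x y :: real assume t: "0 < t" "t < 1"
    have "h ((1 - t) * (x + a) + t * (y + a)) \<le> (1 - t) * h (x + a) + t * h (y + a)"
      using convex_onD[OF hc, of t "x + a" "y + a"] t by simp
    moreover have "(1 - t) * (x + a) + t * (y + a) = (1 - t) * x + t * y + a" by (simp add: algebra_simps)
    ultimately show "r a ((1 - t) *\<^sub>R x + t *\<^sub>R y) \<le> (1 - t) * r a x + t * r a y"
      by (simp add: r_def) (simp add: algebra_simps diff_divide_distrib)
  qed simp
  have concr: "convex_on UNIV (\<lambda>t. -1 * r a t)" if hc: "concave_on UNIV h" for a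
  proof (rule convex_onI)
    fix t x y :: real assume t: "0 < t" "t < 1"
    have "h ((1 - t) * (x + a) + t * (y + a)) \<ge> (1 - t) * h (x + a) + t * h (y + a)"
      using convex_onD[OF hc[unfolded concave_on_def], of t "x + a" "y + a"] t by simp
    moreover have "(1 - t) * (x + a) + t * (y + a) = (1 - t) * x + t * y + a" by (simp add: algebra_simps)
    ultimately show "-1 * r a ((1 - t) *\<^sub>R x + t *\<^sub>R y) \<le> (1 - t) * (-1 * r a x) + t * (-1 * r a y)"
      by (simp add: r_def) (simp add: algebra_simps diff_divide_distrib)
  qed simp
  show ?thesis
  proof (rule that[of S D])
    show "(S has_real_derivative D z) (at z)" for z unfolding D_def by (rule S(2))
    show "continuous_on UNIV D" unfolding D_def
      by (intro continuous_intros continuous_on_std_normal_density continuous_on_compose2[OF qcont] contS)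
        (simp_all add: qne)
    show "\<bar>S z - z\<bar> \<le> K" for z using up[of z] low[of z] by simp
    show "ln c = h (S z) + z\<^sup>2 / 2 - (S z)\<^sup>2 / 2 + ln (D z)" for z
      using ratio[of z] by (simp add: r_def power2_eq_square field_simps)
    show "D z \<ge> 1" if "convex_on UNIV h" for z
    proof -
      obtain x y where "x \<le> z" "y > z" "r (S z - z) x \<le> 0" "r (S z - z) y \<le> 0"
        using cross[where s = 1 and z = z] by auto
      hence "r (S z - z) z \<le> 0" using convex_on_nonpos_between[OF convr[OF that, of "S z - z"], of x y z] by simp
      thus ?thesis using ratio[of z] Dpos[of z] by simp
    qed
    show "D z \<le> 1" if "concave_on UNIV h" for z
    proof -
      obtain x y where "x \<le> z" "y > z" "-1 * r (S z - z) x \<le> 0" "-1 * r (S z - z) y \<le> 0"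
        using cross[where s = "-1" and z = z] by blast
      hence "-1 * r (S z - z) z \<le> 0" using convex_on_nonpos_between[OF concr[OF that, of "S z - z"], of x y z] by simp
      thus ?thesis using ratio[of z] Dpos[of z] by simp
    qed
  qed (rule Dpos)
qed

section \<open>The Gibbs variational inequality for transport maps\<close>

lemma integrable_std_normal_linear_growth:
  fixes f :: "real \<Rightarrow> real"
  assumes f: "continuous_on UNIV f" and bound: "\<And>z. \<bar>f z\<bar> \<le> A + B * \<bar>z\<bar>"
  shows "integrable lborel (\<lambda>z. f z * std_normal_density z)"
proof (rule Bochner_Integration.integrable_bound)
  show "integrable lborel (\<lambda>z. A * std_normal_density z + B * (std_normal_density z * \<bar>z\<bar> ^ 1))"
    by (intro Bochner_Integration.integrable_add integrable_mult_right integrable_std_normal_moment_abs) auto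
  have [measurable]: "f \<in> borel_measurable borel" by (rule borel_measurable_continuous_onI[OF f])
  show "(\<lambda>z. f z * std_normal_density z) \<in> borel_measurable lborel" by measurable
  have "\<bar>f z\<bar> * std_normal_density z \<le> (A + B * \<bar>z\<bar>) * std_normal_density z" for z
    by (intro mult_right_mono bound) simp
  hence "\<bar>f z\<bar> * std_normal_density z \<le> \<bar>A * std_normal_density z + B * (std_normal_density z * \<bar>z\<bar>)\<bar>" for z
    by (smt (verit) distrib_right mult.assoc mult.commute)
  thus "AE z in lborel. norm (f z * std_normal_density z)
      \<le> norm (A * std_normal_density z + B * (std_normal_density z * \<bar>z\<bar> ^ 1))"
    by (intro AE_I2) (simp add: abs_mult)
qed

text \<open>Only an inequality, because \<open>S\<close> is not assumed to be onto; it is the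
  direction that the Gibbs bound needs. The substitution rule on \<open>{- n..n}\<close> is followed
  by monotone convergence.\<close>

lemma nn_integral_substitution_UNIV_le:
  fixes f S D :: "real \<Rightarrow> real"
  assumes f: "f \<in> borel_measurable borel" "\<And>x. f x \<ge> 0"
    and S: "\<And>z. (S has_real_derivative D z) (at z)" and D: "continuous_on UNIV D" "\<And>z. D z \<ge> 0"
  shows "(\<integral>\<^sup>+z. ennreal (f (S z) * D z) \<partial>lborel) \<le> (\<integral>\<^sup>+x. ennreal (f x) \<partial>lborel)"
proof -
  let ?k = "\<lambda>n z. ennreal (f (S z) * D z * indicator {- real n..real n} z)"
  have contS: "continuous_on UNIV S" using DERIV_isCont[OF S] by (simp add: continuous_at_imp_continuous_on)
  have [measurable]: "S \<in> borel_measurable borel" "D \<in> borel_measurable borel" "f \<in> borel_measurable borel"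
    using contS D f by (auto intro: borel_measurable_continuous_onI)
  have "(\<integral>\<^sup>+z. ennreal (f (S z) * D z) \<partial>lborel) = (\<integral>\<^sup>+z. (SUP n. ?k n z) \<partial>lborel)"
  proof (rule nn_integral_cong)
    fix z :: real
    obtain n where n: "\<bar>z\<bar> \<le> real n" using real_arch_simple by blast
    have "(SUP n. ?k n z) = ennreal (f (S z) * D z)"
    proof (rule antisym)
      show "(SUP n. ?k n z) \<le> ennreal (f (S z) * D z)"
        by (intro SUP_least) (auto split: split_indicator)
      have "ennreal (f (S z) * D z) = ?k n z" using n by (auto split: split_indicator)
      also have "\<dots> \<le> (SUP n. ?k n z)" by (rule SUP_upper) simp
      finally show "ennreal (f (S z) * D z) \<le> (SUP n. ?k n z)" .
    qed
    thus "ennreal (f (S z) * D z) = (SUP n. ?k n z)" by simp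
  qed
  also have "\<dots> = (SUP n. \<integral>\<^sup>+z. ?k n z \<partial>lborel)"
  proof (rule nn_integral_monotone_convergence_SUP)
    show "incseq ?k" using f(2) D(2)
      by (intro incseq_SucI le_funI) (auto split: split_indicator)
  qed measurable
  also have "\<dots> \<le> (\<integral>\<^sup>+x. ennreal (f x) \<partial>lborel)"
  proof (rule SUP_least)
    fix n
    have "(\<integral>\<^sup>+z. ?k n z \<partial>lborel)
        = (\<integral>\<^sup>+x. ennreal (f x * indicator {S (- real n)..S (real n)} x) \<partial>lborel)"
      by (rule nn_integral_substitution[symmetric])
        (use S D in \<open>auto simp: set_borel_measurable_def intro: continuous_on_subset\<close>)
    also have "\<dots> \<le> (\<integral>\<^sup>+x. ennreal (f x) \<partial>lborel)"
      by (intro nn_integral_mono) (use f(2) in \<open>auto split: split_indicator\<close>)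
    finally show "(\<integral>\<^sup>+z. ?k n z \<partial>lborel) \<le> (\<integral>\<^sup>+x. ennreal (f x) \<partial>lborel)" .
  qed
  finally show ?thesis .
qed

text \<open>With \<open>S z = z + u\<close> the squares of \<open>z\<close> cancel and
  \<open>- z * u - u^2 / 2\<close> remains, which is linear in \<open>z\<close> for bounded
  \<open>u\<close>.\<close>

lemma transport_growth:
  fixes h S :: "real \<Rightarrow> real"
  assumes h: "K-lipschitz_on UNIV h" and S: "\<bar>S z - z\<bar> \<le> B"
  shows "\<bar>h (S z) + z\<^sup>2 / 2 - (S z)\<^sup>2 / 2\<bar> \<le> (\<bar>h 0\<bar> + K * B + B\<^sup>2 / 2) + (K + B) * \<bar>z\<bar>"
proof -
  define u where "u = S z - z"
  have Sz: "S z = z + u" by (simp add: u_def)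
  have u: "\<bar>u\<bar> \<le> B" using S by (simp add: u_def)
  have K: "K \<ge> 0" using h by (rule lipschitz_on_nonneg)
  have "\<bar>h (S z)\<bar> \<le> \<bar>h 0\<bar> + K * \<bar>z + u\<bar>" using lipschitz_on_abs_le[OF h, of "S z"] by (simp add: Sz)
  moreover have "K * \<bar>z + u\<bar> \<le> K * (\<bar>z\<bar> + B)" using u K by (intro mult_left_mono) auto
  moreover define w where "w = z * u"
  have "z\<^sup>2 / 2 - (S z)\<^sup>2 / 2 = - w - u\<^sup>2 / 2" by (simp add: Sz w_def power2_eq_square field_simps)
  moreover have "\<bar>w\<bar> \<le> B * \<bar>z\<bar>" unfolding w_def using u by (simp add: abs_mult mult.commute[of _ "\<bar>z\<bar>"] mult_left_mono)
  moreover have "u\<^sup>2 \<ge> 0" by simp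
  moreover have "u\<^sup>2 \<le> B\<^sup>2" using u by (simp add: abs_le_square_iff[symmetric])
  moreover have "K * (\<bar>z\<bar> + B) = K * \<bar>z\<bar> + K * B" "(K + B) * \<bar>z\<bar> = K * \<bar>z\<bar> + B * \<bar>z\<bar>"
    by (simp_all add: algebra_simps)
  ultimately show ?thesis by linarith
qed

text \<open>One half of the Gibbs variational principle, for the measure obtained by pushing the
  Gaussian forward along \<open>S\<close>.\<close>

lemma gaussian_transport_le_cgf:
  fixes h S D :: "real \<Rightarrow> real"
  assumes h: "K-lipschitz_on UNIV h"
    and S: "\<And>z. (S has_real_derivative D z) (at z)" "continuous_on UNIV D" "\<And>z. D z > 0"
      "\<And>z. \<bar>S z - z\<bar> \<le> B" "\<And>z. \<bar>ln (D z)\<bar> \<le> A1 + A2 * \<bar>z\<bar>"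
  defines "\<psi> \<equiv> \<lambda>z. h (S z) + z\<^sup>2 / 2 - (S z)\<^sup>2 / 2 + ln (D z)"
  shows "integrable lborel (\<lambda>z. \<psi> z * std_normal_density z)"
    and "(\<integral>z. \<psi> z * std_normal_density z \<partial>lborel) \<le> ln (\<integral>x. exp (h x) * std_normal_density x \<partial>lborel)"
proof -
  let ?\<phi> = std_normal_density
  define c where "c = (\<integral>x. exp (h x) * std_normal_density x \<partial>lborel)"
  have contS: "continuous_on UNIV S" using DERIV_isCont[OF S(1)] by (simp add: continuous_at_imp_continuous_on)
  have Dne: "D z \<noteq> 0" for z using S(3)[of z] by simp
  have conth: "continuous_on UNIV h" by (rule lipschitz_on_continuous_on[OF h])
  have cont\<psi>: "continuous_on UNIV \<psi>" unfolding \<psi>_def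
    by (intro continuous_intros contS S continuous_on_compose2[OF conth]) (simp_all add: Dne)
  have "\<bar>\<psi> z\<bar> \<le> (\<bar>h 0\<bar> + K * B + B\<^sup>2 / 2 + A1) + (K + B + A2) * \<bar>z\<bar>" for z
  proof -
    have "\<bar>\<psi> z\<bar> \<le> \<bar>h (S z) + z\<^sup>2 / 2 - (S z)\<^sup>2 / 2\<bar> + \<bar>ln (D z)\<bar>"
      unfolding \<psi>_def by (rule abs_triangle_ineq)
    also have "\<dots> \<le> ((\<bar>h 0\<bar> + K * B + B\<^sup>2 / 2) + (K + B) * \<bar>z\<bar>) + (A1 + A2 * \<bar>z\<bar>)"
      by (intro add_mono transport_growth h S)
    finally show ?thesis by (simp add: algebra_simps)
  qed
  with cont\<psi> show int\<psi>: "integrable lborel (\<lambda>z. \<psi> z * ?\<phi> z)"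
    by (rule integrable_std_normal_linear_growth)
  have inth: "integrable lborel (\<lambda>x. exp (h x) * ?\<phi> x)" by (rule integrable_exp_lipschitz_std_normal[OF h])
  have c: "c > 0" unfolding c_def by (rule integral_exp_std_normal_pos[OF inth])
  \<comment> \<open>The integrand \<open>exp (\<psi> z)\<close> times the density is the pullback
    along \<open>S\<close> of the tilted Gaussian density, so its integral is at most
    \<open>c\<close>.\<close>
  have eq: "exp (\<psi> z) * ?\<phi> z = exp (h (S z)) * ?\<phi> (S z) * D z" for z
  proof -
    have "exp (\<psi> z) * exp (- z\<^sup>2 / 2) = exp (h (S z) + (- (S z)\<^sup>2 / 2) + ln (D z))"
      by (simp add: \<psi>_def exp_add[symmetric])
    also have "\<dots> = exp (h (S z)) * exp (- (S z)\<^sup>2 / 2) * D z"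
      using S(3)[of z] by (simp only: exp_add exp_ln)
    finally show ?thesis by (simp add: std_normal_density_def)
  qed
  have [measurable]: "\<psi> \<in> borel_measurable borel" "h \<in> borel_measurable borel"
    using cont\<psi> conth by (auto intro: borel_measurable_continuous_onI)
  have "(\<integral>\<^sup>+z. ennreal (exp (\<psi> z) * ?\<phi> z) \<partial>lborel) \<le> (\<integral>\<^sup>+x. ennreal (exp (h x) * ?\<phi> x) \<partial>lborel)"
    unfolding eq using S(3)
    by (intro nn_integral_substitution_UNIV_le S) (auto intro: less_imp_le)
  also have "\<dots> = ennreal c" unfolding c_def by (intro nn_integral_eq_integral inth) auto
  finally have le: "(\<integral>\<^sup>+z. ennreal (exp (\<psi> z) * ?\<phi> z) \<partial>lborel) \<le> ennreal c" .
  have inte: "integrable lborel (\<lambda>z. exp (\<psi> z) * ?\<phi> z)"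
    by (rule integrableI_nonneg) (use le_less_trans[OF le, of top] in auto)
  have le': "(\<integral>z. exp (\<psi> z) * ?\<phi> z \<partial>lborel) \<le> c"
    using le c by (subst (asm) nn_integral_eq_integral[OF inte]) auto
  \<comment> \<open>Jensen's inequality in the form \<open>1 + x \<le> exp x\<close> with
    \<open>x = \<psi> z - ln c\<close>; the right-hand side integrates to at most 1.\<close>
  have "(\<integral>z. (\<psi> z * ?\<phi> z + (1 - ln c) * ?\<phi> z) \<partial>lborel) \<le> (\<integral>z. exp (\<psi> z) * ?\<phi> z / c \<partial>lborel)"
  proof (rule integral_mono)
    fix z
    have "\<psi> z + (1 - ln c) \<le> exp (\<psi> z) / c"
      using exp_ge_add_one_self[of "\<psi> z - ln c"] c by (simp add: exp_diff)
    from mult_right_mono[OF this, of "?\<phi> z"]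
    show "\<psi> z * ?\<phi> z + (1 - ln c) * ?\<phi> z \<le> exp (\<psi> z) * ?\<phi> z / c" by (simp add: distrib_right)
  qed (use int\<psi> inte in auto)
  also have "\<dots> \<le> 1" using le' c by simp
  finally show "(\<integral>z. \<psi> z * ?\<phi> z \<partial>lborel) \<le> ln c" using int\<psi> by simp
qed

section \<open>Gaussian integration by parts\<close>

lemma std_normal_density_DERIV:
  "(std_normal_density has_real_derivative - z * std_normal_density z) (at z)"
proof -
  have "((\<lambda>z. 1 / sqrt (2 * pi) * exp (- z\<^sup>2 / 2)) has_real_derivative
      1 / sqrt (2 * pi) * (exp (- z\<^sup>2 / 2) * (- z))) (at z)"
    by (intro DERIV_cmult DERIV_fun_exp) (auto intro!: derivative_eq_intros)
  thus ?thesis by (simp add: std_normal_density_def[abs_def] mult_ac)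
qed

lemma std_normal_density_at_infinity:
  "(std_normal_density \<longlongrightarrow> 0) at_top" "(std_normal_density \<longlongrightarrow> 0) at_bot"
proof -
  show *: "(std_normal_density \<longlongrightarrow> 0) at_top"
  proof (rule Lim_null_comparison)
    have "exp (- x\<^sup>2 / 2) \<le> exp (- x / 2)" if "x \<ge> 1" for x :: real
      using that by (simp add: power2_eq_square)
    hence "norm (std_normal_density x) \<le> 1 / sqrt (2 * pi) * exp (- x / 2)" if "x \<ge> 1" for x :: real
      using that by (simp add: std_normal_density_def divide_right_mono)
    thus "\<forall>\<^sub>F x in at_top. norm (std_normal_density x) \<le> 1 / sqrt (2 * pi) * exp (- x / 2)"
      using eventually_ge_at_top[of "1 :: real"] by (rule eventually_mono[rotated])
    have "filterlim (\<lambda>x::real. 1 / 2 * x) at_top at_top"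
      by (intro filterlim_tendsto_pos_mult_at_top[OF tendsto_const] filterlim_ident) simp
    hence "filterlim (\<lambda>x::real. - x / 2) at_bot at_top" by (simp add: filterlim_uminus_at_top)
    hence "((\<lambda>x::real. exp (- x / 2)) \<longlongrightarrow> 0) at_top" by (rule filterlim_compose[OF exp_at_bot])
    thus "((\<lambda>x. 1 / sqrt (2 * pi) * exp (- x / 2)) \<longlongrightarrow> 0) at_top" by (rule tendsto_mult_right_zero)
  qed
  show "(std_normal_density \<longlongrightarrow> 0) at_bot"
  proof -
    have "(\<lambda>x. std_normal_density (- x)) = std_normal_density" by (simp add: fun_eq_iff normal_density_def)
    thus ?thesis unfolding filterlim_at_bot_mirror using * by simp
  qed
qed

text \<open>Minus the product of \<open>u\<close> and the density is a primitive of the integrand,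
  because the density has derivative \<open>- z\<close> times itself. It vanishes at both infinities
  as \<open>u\<close> is bounded.\<close>

lemma gaussian_integration_by_parts:
  fixes u u' :: "real \<Rightarrow> real"
  assumes u: "\<And>z. (u has_real_derivative u' z) (at z)" "continuous_on UNIV u'"
    and B: "\<And>z. \<bar>u z\<bar> \<le> B" "\<And>z. \<bar>u' z\<bar> \<le> B'"
  shows "integrable lborel (\<lambda>z. (z * u z - u' z) * std_normal_density z)" (is ?int)
    and "(\<integral>z. (z * u z - u' z) * std_normal_density z \<partial>lborel) = 0"
proof -
  let ?\<phi> = std_normal_density
  have contu: "continuous_on UNIV u" using DERIV_isCont[OF u(1)] by (simp add: continuous_at_imp_continuous_on)
  have cont: "continuous_on UNIV (\<lambda>z. (z * u z - u' z) * ?\<phi> z)"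
    by (intro continuous_intros contu u continuous_on_std_normal_density)
  show int: ?int
  proof (rule integrable_std_normal_linear_growth)
    show "\<bar>z * u z - u' z\<bar> \<le> B' + B * \<bar>z\<bar>" for z
    proof -
      have "\<bar>z * u z\<bar> \<le> B * \<bar>z\<bar>" using B(1)[of z] by (simp add: abs_mult mult.commute[of B] mult_left_mono)
      thus ?thesis using B(2)[of z] by linarith
    qed
  qed (intro continuous_intros contu u)
  have lim: "((\<lambda>z. - (u z * ?\<phi> z)) \<longlongrightarrow> 0) F" if F: "(?\<phi> \<longlongrightarrow> 0) F" for F
  proof (rule Lim_null_comparison)
    have "\<bar>u z\<bar> * ?\<phi> z \<le> B * ?\<phi> z" for z by (intro mult_right_mono B) auto
    thus "\<forall>\<^sub>F z in F. norm (- (u z * ?\<phi> z)) \<le> B * ?\<phi> z" by (simp add: abs_mult)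
    show "((\<lambda>z. B * ?\<phi> z) \<longlongrightarrow> 0) F" using F by (rule tendsto_mult_right_zero)
  qed
  have "(LBINT z=-\<infinity>..\<infinity>. (z * u z - u' z) * ?\<phi> z) = 0 - 0"
  proof (rule interval_integral_FTC_integrable)
    show "((\<lambda>z. - (u z * ?\<phi> z)) has_vector_derivative (z * u z - u' z) * ?\<phi> z) (at z)" for z
      unfolding has_real_derivative_iff_has_vector_derivative[symmetric]
      by (rule derivative_eq_intros u std_normal_density_DERIV refl)+ (simp add: algebra_simps)
    show "isCont (\<lambda>z. (z * u z - u' z) * ?\<phi> z) z" for z
      using cont by (simp add: continuous_on_eq_continuous_at)
    show "set_integrable lborel (einterval (- \<infinity>) \<infinity>) (\<lambda>z. (z * u z - u' z) * ?\<phi> z)"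
      using int by (simp add: set_integrable_def)
    show "(((\<lambda>z. - (u z * ?\<phi> z)) \<circ> real_of_ereal) \<longlongrightarrow> 0) (at_right (- \<infinity>))"
      unfolding ereal_tendsto_simps by (rule lim[OF std_normal_density_at_infinity(2)])
    show "(((\<lambda>z. - (u z * ?\<phi> z)) \<circ> real_of_ereal) \<longlongrightarrow> 0) (at_left \<infinity>)"
      unfolding ereal_tendsto_simps by (rule lim[OF std_normal_density_at_infinity(1)])
  qed simp
  thus "(\<integral>z. (z * u z - u' z) * ?\<phi> z \<partial>lborel) = 0"
    by (simp add: interval_lebesgue_integral_def set_lebesgue_integral_def)
qed

section \<open>The one-dimensional inequality\<close>

definition normal_cgf :: "(real \<Rightarrow> real) \<Rightarrow> real \<Rightarrow> real" where
  "normal_cgf G l = ln (\<integral>x. exp (l * G x) * std_normal_density x \<partial>lborel) / l"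

lemma std_normal_integral_const:
  "integrable lborel (\<lambda>z. a * std_normal_density z)" "(\<integral>z. a * std_normal_density z \<partial>lborel) = a"
  by (simp_all add: integrable_mult_right del: integrable_mult_right_iff)

text \<open>Adds to \<open>gaussian_transport\<close> the growth bound on \<open>ln (D z)\<close>
  that \<open>gaussian_transport_le_cgf\<close> requires; it comes from solving the equation of the
  optimal map for \<open>ln (D z)\<close>.\<close>

lemma gaussian_transport_exists:
  fixes h :: "real \<Rightarrow> real"
  assumes h: "K-lipschitz_on UNIV h"
  defines "c \<equiv> \<integral>x. exp (h x) * std_normal_density x \<partial>lborel"
  shows "\<exists>S D A1 A2. (\<forall>z. (S has_real_derivative D z) (at z)) \<and> continuous_on UNIV D \<and> (\<forall>z. D z > 0) \<and>
      (\<forall>z. \<bar>S z - z\<bar> \<le> K) \<and> (\<forall>z. ln c = h (S z) + z\<^sup>2 / 2 - (S z)\<^sup>2 / 2 + ln (D z)) \<and>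
      (convex_on UNIV h \<longrightarrow> (\<forall>z. D z \<ge> 1)) \<and> (concave_on UNIV h \<longrightarrow> (\<forall>z. D z \<le> 1)) \<and>
      (\<forall>z. \<bar>ln (D z)\<bar> \<le> A1 + A2 * \<bar>z\<bar>)"
proof (rule gaussian_transport[OF h])
  fix S D :: "real \<Rightarrow> real"
  assume S: "\<And>z. (S has_real_derivative D z) (at z)" "continuous_on UNIV D" "\<And>z. D z > 0"
    and B: "\<And>z. \<bar>S z - z\<bar> \<le> K"
    and eq: "\<And>z. ln (\<integral>x. exp (h x) * std_normal_density x \<partial>lborel) = h (S z) + z\<^sup>2 / 2 - (S z)\<^sup>2 / 2 + ln (D z)"
    and cv: "convex_on UNIV h \<Longrightarrow> (\<And>z. D z \<ge> 1)" and cc: "concave_on UNIV h \<Longrightarrow> (\<And>z. D z \<le> 1)"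
  have "\<bar>ln (D z)\<bar> \<le> (\<bar>ln c\<bar> + (\<bar>h 0\<bar> + K * K + K\<^sup>2 / 2)) + (K + K) * \<bar>z\<bar>" for z
  proof -
    have "\<bar>ln (D z)\<bar> \<le> \<bar>ln c\<bar> + \<bar>h (S z) + z\<^sup>2 / 2 - (S z)\<^sup>2 / 2\<bar>"
      using eq[of z] unfolding c_def by linarith
    also have "\<dots> \<le> \<bar>ln c\<bar> + ((\<bar>h 0\<bar> + K * K + K\<^sup>2 / 2) + (K + K) * \<bar>z\<bar>)"
      by (intro add_left_mono transport_growth h B)
    finally show ?thesis by (simp only: add.assoc)
  qed
  with S B eq[folded c_def] cv cc show ?thesis by (intro exI conjI allI impI)
qed

text \<open>\<open>G\<close>, \<open>G0\<close> and \<open>G1\<close> stand for the sections of one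
  jointly convex function at the middle parameter and the endpoints, and \<open>le\<close> is its
  joint convexity. Convexity of the middle section makes its optimal map expanding.\<close>

lemma normal_cgf_convex_pos:
  fixes G G0 G1 :: "real \<Rightarrow> real"
  assumes lip: "K-lipschitz_on UNIV G" "K-lipschitz_on UNIV G0" "K-lipschitz_on UNIV G1"
    and conv: "convex_on UNIV G"
    and le: "\<And>x y. G ((1 - s) * x + s * y) \<le> (1 - s) * G0 x + s * G1 y"
    and s: "0 < s" "s < 1" and l: "l0 > 0" "l1 > 0"
  shows "normal_cgf G ((1 - s) * l0 + s * l1) \<le> (1 - s) * normal_cgf G0 l0 + s * normal_cgf G1 l1"
proof -
  let ?\<phi> = std_normal_density
  define l where "l = (1 - s) * l0 + s * l1"
  have lpos: "l > 0" using s l by (simp add: l_def add_pos_pos)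
  define c where "c = (\<integral>x. exp (l * G x) * std_normal_density x \<partial>lborel)"
  have "convex_on UNIV (\<lambda>x. l * G x)" using conv lpos by (simp add: convex_on_cmul)
  then obtain S D A1 A2 where S: "\<And>z. (S has_real_derivative D z) (at z)" and D: "continuous_on UNIV D" "\<And>z. D z > 0"
    and B: "\<And>z. \<bar>S z - z\<bar> \<le> \<bar>l\<bar> * K"
    and eq: "\<And>z. ln c = l * G (S z) + z\<^sup>2 / 2 - (S z)\<^sup>2 / 2 + ln (D z)" and D1: "\<And>z. D z \<ge> 1"
    and lnD: "\<And>z. \<bar>ln (D z)\<bar> \<le> A1 + A2 * \<bar>z\<bar>"
    using gaussian_transport_exists[OF lipschitz_on_cmult_real[OF lip(1), of l]] unfolding c_def by blast
  define v where "v = (\<lambda>z. (S z - z) / l)"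
  define a where "a = (\<lambda>z. (D z - 1) / l)"
  have Sv: "S z = z + l * v z" and Da: "D z = 1 + l * a z" for z using lpos by (auto simp: v_def a_def)
  have a0: "a z \<ge> 0" for z using D1[of z] lpos by (simp add: a_def)
  define \<psi> where "\<psi> = (\<lambda>m Gm z. m * Gm (z + m * v z) + z\<^sup>2 / 2 - (z + m * v z)\<^sup>2 / 2 + ln (1 + m * a z))"
  have end1: "integrable lborel (\<lambda>z. \<psi> m Gm z * ?\<phi> z)"
    and end2: "(\<integral>z. \<psi> m Gm z * ?\<phi> z \<partial>lborel) \<le> m * normal_cgf Gm m"
    if m: "m > 0" and lipm: "K-lipschitz_on UNIV Gm" for m Gm
  proof -
    have der: "((\<lambda>z. z + m * v z) has_real_derivative 1 + m * a z) (at z)" for z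
      unfolding v_def a_def using lpos by (auto intro!: derivative_eq_intros S)
    have cont: "continuous_on UNIV (\<lambda>z. 1 + m * a z)"
      unfolding a_def using lpos by (intro continuous_intros D) auto
    have pos: "1 + m * a z > 0" for z using a0[of z] m by (simp add: add_pos_nonneg)
    have bd: "\<bar>(z + m * v z) - z\<bar> \<le> m * K" for z
    proof -
      have "\<bar>v z\<bar> \<le> K" using B[of z] lpos by (simp add: v_def abs_div mult.commute pos_divide_le_eq)
      thus ?thesis using m by (simp add: abs_mult mult_left_mono)
    qed
    \<comment> \<open>Since \<open>D z \<ge> 1\<close>, the derivative \<open>1 + m * a z\<close>
      lies between 1 and \<open>(1 + m / l) * D z\<close>.\<close>
    have lnb: "\<bar>ln (1 + m * a z)\<bar> \<le> (ln (1 + m / l) + A1) + A2 * \<bar>z\<bar>" for z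
    proof -
      have "1 + m * a z \<le> (1 + m / l) * D z"
      proof -
        have "m * a z = m / l * (D z - 1)" by (simp add: a_def)
        hence "(1 + m / l) * D z - (1 + m * a z) = (D z - 1) + m / l" by (simp add: algebra_simps)
        moreover have "m / l > 0" using m lpos by simp
        ultimately show ?thesis using D1[of z] by linarith
      qed
      hence "ln (1 + m * a z) \<le> ln ((1 + m / l) * D z)" using pos[of z] by (subst ln_le_cancel_iff) auto
      also have "\<dots> = ln (1 + m / l) + ln (D z)" using D(2)[of z] m lpos
        by (intro ln_mult_pos) (auto simp: add_pos_pos)
      finally have "ln (1 + m * a z) \<le> ln (1 + m / l) + ln (D z)" .
      moreover have "0 \<le> ln (1 + m * a z)" using m a0[of z] by simp
      ultimately show ?thesis using lnD[of z] by linarith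
    qed
    from gaussian_transport_le_cgf[OF lipschitz_on_cmult_real[OF lipm] der cont pos bd lnb, of m] m
    show "integrable lborel (\<lambda>z. \<psi> m Gm z * ?\<phi> z)"
      "(\<integral>z. \<psi> m Gm z * ?\<phi> z \<partial>lborel) \<le> m * normal_cgf Gm m"
      by (simp_all add: \<psi>_def normal_cgf_def)
  qed
  \<comment> \<open>At the optimal map \<open>\<psi> l G z\<close> equals \<open>ln c\<close> for
    every \<open>z\<close>, so the comparison can be made pointwise and integrated
    afterwards.\<close>
  have pw: "ln c / l \<le> (1 - s) * (\<psi> l0 G0 z / l0) + s * (\<psi> l1 G1 z / l1)" for z
  proof -
    define f where "f = (\<lambda>m. ln (1 + m * a z) / m)"
    have f: "f l \<le> (1 - s) * f l0 + s * f l1"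
      using convex_onD[OF convex_on_ln_one_plus_over[OF a0[of z]], of s l0 l1] s l
      by (simp add: f_def l_def)
    have "S z = (1 - s) * (z + l0 * v z) + s * (z + l1 * v z)" by (simp add: Sv l_def algebra_simps)
    hence G: "G (S z) \<le> (1 - s) * G0 (z + l0 * v z) + s * G1 (z + l1 * v z)" using le by simp
    have \<psi>': "\<psi> m Gm z / m = Gm (z + m * v z) - z * v z - m * (v z)\<^sup>2 / 2 + f m" if "m > 0" for m Gm
      using that by (simp add: \<psi>_def f_def field_simps power2_eq_square)
    have "ln c / l = \<psi> l G z / l" using eq[of z] by (simp add: \<psi>_def Sv Da)
    also have "\<dots> = G (S z) - z * v z - l * (v z)\<^sup>2 / 2 + f l" using \<psi>'[OF lpos] by (simp add: Sv)
    also have "\<dots> \<le> (1 - s) * (G0 (z + l0 * v z) - z * v z - l0 * (v z)\<^sup>2 / 2 + f l0)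
        + s * (G1 (z + l1 * v z) - z * v z - l1 * (v z)\<^sup>2 / 2 + f l1)"
    proof -
      have "l * (v z)\<^sup>2 / 2 = (1 - s) * (l0 * (v z)\<^sup>2 / 2) + s * (l1 * (v z)\<^sup>2 / 2)"
        by (simp add: l_def field_simps)
      moreover have "z * v z = (1 - s) * (z * v z) + s * (z * v z)" by (simp add: algebra_simps)
      ultimately show ?thesis using f G by (simp only: distrib_left right_diff_distrib)
    qed
    finally show ?thesis using \<psi>' l by simp
  qed
  have int0: "integrable lborel (\<lambda>z. \<psi> l0 G0 z * ?\<phi> z)" and int1: "integrable lborel (\<lambda>z. \<psi> l1 G1 z * ?\<phi> z)"
    using end1 l lip by auto
  have "ln c / l = (\<integral>z. ln c / l * ?\<phi> z \<partial>lborel)" by simp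
  also have "\<dots> \<le> (\<integral>z. (1 - s) / l0 * (\<psi> l0 G0 z * ?\<phi> z) + s / l1 * (\<psi> l1 G1 z * ?\<phi> z) \<partial>lborel)"
  proof (rule integral_mono)
    show "ln c / l * ?\<phi> z \<le> (1 - s) / l0 * (\<psi> l0 G0 z * ?\<phi> z) + s / l1 * (\<psi> l1 G1 z * ?\<phi> z)" for z
      using mult_right_mono[OF pw[of z], of "?\<phi> z"] by (simp add: distrib_right)
  qed (intro Bochner_Integration.integrable_add integrable_mult_right int0 int1 std_normal_integral_const)+
  also have "\<dots> = (1 - s) / l0 * (\<integral>z. \<psi> l0 G0 z * ?\<phi> z \<partial>lborel) + s / l1 * (\<integral>z. \<psi> l1 G1 z * ?\<phi> z \<partial>lborel)"
    using int0 int1 by simp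
  also have "\<dots> \<le> (1 - s) / l0 * (l0 * normal_cgf G0 l0) + s / l1 * (l1 * normal_cgf G1 l1)"
    using s l lip by (intro add_mono mult_left_mono end2) auto
  also have "\<dots> = (1 - s) * normal_cgf G0 l0 + s * normal_cgf G1 l1" using l by simp
  finally show ?thesis by (simp add: normal_cgf_def c_def l_def)
qed

text \<open>The middle value is now an infimum, so any test map bounds it from above; convexity of
  the endpoint sections makes the two maps that are combined contracting.\<close>

lemma normal_cgf_convex_neg:
  fixes G G0 G1 :: "real \<Rightarrow> real"
  assumes lip: "K-lipschitz_on UNIV G" "K-lipschitz_on UNIV G0" "K-lipschitz_on UNIV G1"
    and conv: "convex_on UNIV G0" "convex_on UNIV G1"
    and le: "\<And>x y. G ((1 - s) * x + s * y) \<le> (1 - s) * G0 x + s * G1 y"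
    and s: "0 < s" "s < 1" and l: "l0 < 0" "l1 < 0"
  shows "normal_cgf G ((1 - s) * l0 + s * l1) \<le> (1 - s) * normal_cgf G0 l0 + s * normal_cgf G1 l1"
proof -
  let ?\<phi> = std_normal_density
  define m0 m1 m where "m0 = - l0" "m1 = - l1" "m = (1 - s) * m0 + s * m1"
  have "m0 > 0" "m1 > 0" using l by (simp_all add: m0_m1_m_def)
  hence mpos: "m0 > 0" "m1 > 0" "m > 0" unfolding m0_m1_m_def(3) using s by (simp_all add: add_pos_pos)
  have ml: "(1 - s) * l0 + s * l1 = - m" "l0 = - m0" "l1 = - m1" by (simp_all add: m0_m1_m_def algebra_simps)
  have K: "K \<ge> 0" using lip(1) by (rule lipschitz_on_nonneg)
  define p where "p = (\<lambda>x::real. x - 1 - ln x)"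
  have transport: "\<exists>S D A1 A2. (\<forall>z. (S has_real_derivative D z) (at z)) \<and> continuous_on UNIV D \<and> (\<forall>z. D z > 0) \<and>
      (\<forall>z. \<bar>S z - z\<bar> \<le> n * K) \<and>
      (\<forall>z. Gn (S z) = normal_cgf Gn (- n) + (z\<^sup>2 / 2 - (S z)\<^sup>2 / 2 + ln (D z)) / n) \<and> (\<forall>z. D z \<le> 1) \<and>
      (\<forall>z. \<bar>ln (D z)\<bar> \<le> A1 + A2 * \<bar>z\<bar>)"
    if n: "n > 0" and lipn: "K-lipschitz_on UNIV Gn" and convn: "convex_on UNIV Gn" for n Gn
  proof -
    define c where "c = (\<integral>x. exp (- n * Gn x) * std_normal_density x \<partial>lborel)"
    have "concave_on UNIV (\<lambda>x. - n * Gn x)"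
      using convex_on_cmul[OF _ convn, of n] n by (simp add: concave_on_def)
    then obtain S D A1 A2 where S: "\<And>z. (S has_real_derivative D z) (at z)" and D: "continuous_on UNIV D" "\<And>z. D z > 0"
      and B: "\<And>z. \<bar>S z - z\<bar> \<le> \<bar>- n\<bar> * K"
      and eq: "\<And>z. ln c = - n * Gn (S z) + z\<^sup>2 / 2 - (S z)\<^sup>2 / 2 + ln (D z)" and D1: "\<And>z. D z \<le> 1"
      and lnD: "\<And>z. \<bar>ln (D z)\<bar> \<le> A1 + A2 * \<bar>z\<bar>"
      using gaussian_transport_exists[OF lipschitz_on_cmult_real[OF lipn, of "- n"]] unfolding c_def by blast
    have "Gn (S z) = normal_cgf Gn (- n) + (z\<^sup>2 / 2 - (S z)\<^sup>2 / 2 + ln (D z)) / n" for z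
    proof -
      have "n * Gn (S z) = - ln c + (z\<^sup>2 / 2 - (S z)\<^sup>2 / 2 + ln (D z))" using eq[of z] by simp
      hence "Gn (S z) = (- ln c + (z\<^sup>2 / 2 - (S z)\<^sup>2 / 2 + ln (D z))) / n" using n by (metis nonzero_mult_div_cancel_left less_irrefl)
      thus ?thesis by (simp add: normal_cgf_def c_def add_divide_distrib diff_divide_distrib)
    qed
    moreover have "\<bar>S z - z\<bar> \<le> n * K" for z using B[of z] n by simp
    ultimately show ?thesis using S D D1 lnD by blast
  qed
  obtain S0 D0 A10 A20 where S0: "\<And>z. (S0 has_real_derivative D0 z) (at z)" "continuous_on UNIV D0" "\<And>z. D0 z > 0"
      "\<And>z. \<bar>S0 z - z\<bar> \<le> m0 * K"
      "\<And>z. G0 (S0 z) = normal_cgf G0 (- m0) + (z\<^sup>2 / 2 - (S0 z)\<^sup>2 / 2 + ln (D0 z)) / m0" "\<And>z. D0 z \<le> 1"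
      "\<And>z. \<bar>ln (D0 z)\<bar> \<le> A10 + A20 * \<bar>z\<bar>"
    using transport[OF mpos(1) lip(2) conv(1)] by blast
  obtain S1 D1 A11 A21 where S1: "\<And>z. (S1 has_real_derivative D1 z) (at z)" "continuous_on UNIV D1" "\<And>z. D1 z > 0"
      "\<And>z. \<bar>S1 z - z\<bar> \<le> m1 * K"
      "\<And>z. G1 (S1 z) = normal_cgf G1 (- m1) + (z\<^sup>2 / 2 - (S1 z)\<^sup>2 / 2 + ln (D1 z)) / m1" "\<And>z. D1 z \<le> 1"
      "\<And>z. \<bar>ln (D1 z)\<bar> \<le> A11 + A21 * \<bar>z\<bar>"
    using transport[OF mpos(2) lip(3) conv(2)] by blast
  define S where "S = (\<lambda>z. (1 - s) * S0 z + s * S1 z)"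
  define D where "D = (\<lambda>z. (1 - s) * D0 z + s * D1 z)"
  have S: "(S has_real_derivative D z) (at z)" for z
    unfolding S_def D_def by (auto intro!: derivative_eq_intros S0 S1)
  have D: "continuous_on UNIV D" unfolding D_def by (intro continuous_intros S0 S1)
  have Dpos: "D z > 0" for z unfolding D_def using s S0(3) S1(3) by (simp add: add_pos_pos)
  have D1': "D z \<le> 1" for z unfolding D_def using convex_bound_le[OF S0(6) S1(6), of "1 - s" s] s by simp
  have B: "\<bar>S z - z\<bar> \<le> m * K" for z
  proof -
    have "S z - z = (1 - s) * (S0 z - z) + s * (S1 z - z)" by (simp add: S_def algebra_simps)
    also have "\<bar>\<dots>\<bar> \<le> \<bar>(1 - s) * (S0 z - z)\<bar> + \<bar>s * (S1 z - z)\<bar>" by (rule abs_triangle_ineq)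
    also have "\<dots> \<le> (1 - s) * (m0 * K) + s * (m1 * K)"
      unfolding abs_mult using s by (intro add_mono mult_mono S0 S1) (use mpos K in auto)
    finally show ?thesis by (simp add: m0_m1_m_def algebra_simps)
  qed
  have lnD: "\<bar>ln (D z)\<bar> \<le> (A10 + A11) + (A20 + A21) * \<bar>z\<bar>" for z
  proof -
    have "min (D0 z) (D1 z) \<le> D z"
    proof -
      have "(1 - s) * min (D0 z) (D1 z) + s * min (D0 z) (D1 z) \<le> D z"
        unfolding D_def using s by (intro add_mono mult_left_mono) auto
      thus ?thesis by (simp add: algebra_simps)
    qed
    hence "ln (min (D0 z) (D1 z)) \<le> ln (D z)"
      using S0(3)[of z] S1(3)[of z] Dpos[of z] by (subst ln_le_cancel_iff) auto
    moreover have "ln (D z) \<le> 0" "ln (D0 z) \<le> 0" "ln (D1 z) \<le> 0"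
      using D1' S0(6) S1(6) S0(3) S1(3) Dpos by (simp_all)
    ultimately have "\<bar>ln (D z)\<bar> \<le> \<bar>ln (D0 z)\<bar> + \<bar>ln (D1 z)\<bar>" by (auto simp: min_def split: if_splits)
    thus ?thesis using S0(7)[of z] S1(7)[of z] by (simp add: algebra_simps)
  qed
  have "(\<bar>- m\<bar> * K)-lipschitz_on UNIV (\<lambda>x. - m * G x)" by (rule lipschitz_on_cmult_real[OF lip(1)])
  note J = gaussian_transport_le_cgf[OF this S D Dpos B lnD]
  have ibp: "integrable lborel (\<lambda>z. (z * (T z - z) - (T' z - 1)) * ?\<phi> z)"
    "(\<integral>z. (z * (T z - z) - (T' z - 1)) * ?\<phi> z \<partial>lborel) = 0"
    if T: "\<And>z. (T has_real_derivative T' z) (at z)" "continuous_on UNIV T'" "\<And>z. T' z > 0" "\<And>z. T' z \<le> 1"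
      "\<And>z. \<bar>T z - z\<bar> \<le> b" for T T' b
  proof -
    have der: "((\<lambda>z. T z - z) has_real_derivative T' z - 1) (at z)" for z
      by (auto intro!: derivative_eq_intros T)
    have cont: "continuous_on UNIV (\<lambda>z. T' z - 1)" by (intro continuous_intros T)
    have bd: "\<bar>T' z - 1\<bar> \<le> 1" for z using T(3)[of z] T(4)[of z] by simp
    show "integrable lborel (\<lambda>z. (z * (T z - z) - (T' z - 1)) * ?\<phi> z)"
      "(\<integral>z. (z * (T z - z) - (T' z - 1)) * ?\<phi> z \<partial>lborel) = 0"
      by (rule gaussian_integration_by_parts[OF der cont T(5) bd])+
  qed
  note I = ibp[OF S D Dpos D1' B] and I0 = ibp[OF S0(1-3,6,4)] and I1 = ibp[OF S1(1-3,6,4)]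
  let ?N = "\<lambda>T T' z. (z * (T z - z) - (T' z - 1)) * ?\<phi> z"
  \<comment> \<open>The last bracket has no definite sign at a given \<open>z\<close>. Each of its
    three terms integrates to 0 against the Gaussian by \<open>ibp\<close>.\<close>
  have pw: "- ((- m * G (S z) + z\<^sup>2 / 2 - (S z)\<^sup>2 / 2 + ln (D z)) / m)
      \<le> (1 - s) * normal_cgf G0 (- m0) + s * normal_cgf G1 (- m1) + ((z * (S z - z) - (D z - 1)) / m
        - (1 - s) * ((z * (S0 z - z) - (D0 z - 1)) / m0) - s * ((z * (S1 z - z) - (D1 z - 1)) / m1))" for z
  proof -
    define u u0 u1 where "u = S z - z" "u0 = S0 z - z" "u1 = S1 z - z"
    have u: "u = (1 - s) * u0 + s * u1" by (simp add: u_u0_u1_def S_def algebra_simps)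
    \<comment> \<open>Joint convexity of \<open>u^2 / m\<close>, with the deficit written out as a
      square.\<close>
    have quad: "u\<^sup>2 / 2 / m \<le> (1 - s) * (u0\<^sup>2 / 2 / m0) + s * (u1\<^sup>2 / 2 / m1)"
    proof -
      have "((1 - s) * (u0\<^sup>2 / m0) + s * (u1\<^sup>2 / m1)) * m - u\<^sup>2
         = s * (1 - s) * (u0 * m1 - u1 * m0)\<^sup>2 / (m0 * m1)"
        using mpos(1,2) unfolding u m0_m1_m_def(3) by (simp add: field_simps power2_eq_square)
      also have "\<dots> \<ge> 0" using mpos s by simp
      finally have "u\<^sup>2 / m \<le> (1 - s) * (u0\<^sup>2 / m0) + s * (u1\<^sup>2 / m1)" using mpos(3) by (simp add: pos_divide_le_eq)
      note quad0 = this
      have lin: "(1 - s) * (q / 2) + s * (r / 2) = ((1 - s) * q + s * r) / 2" for q r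
        by (simp add: field_simps)
      have half: "x / 2 / n = x / n / 2" for x n :: real by simp
      from quad0 show ?thesis unfolding half lin by (rule divide_right_mono) simp
    qed
    have pp: "p (D z) / m \<le> (1 - s) * (p (D0 z) / m0) + s * (p (D1 z) / m1)"
      unfolding p_def D_def m0_m1_m_def(3)
      by (rule sub_one_minus_ln_perspective_convex) (use S0 S1 mpos s in auto)
    \<comment> \<open>Adding and subtracting \<open>T' z - 1\<close> splits the cost into the term
      removed by integration by parts, the squared displacement, and
      \<open>p (T' z)\<close>.\<close>
    have E: "(z\<^sup>2 / 2 - (T z)\<^sup>2 / 2 + ln (T' z)) / n
      = - ((z * (T z - z) - (T' z - 1)) / n) - (T z - z)\<^sup>2 / 2 / n - p (T' z) / n" for T T' :: "real \<Rightarrow> real" and n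
      unfolding p_def by (cases "n = 0") (simp_all add: field_simps power2_eq_square)
    have "G (S z) \<le> (1 - s) * G0 (S0 z) + s * G1 (S1 z)" unfolding S_def by (rule le)
    moreover have "- ((- m * G (S z) + z\<^sup>2 / 2 - (S z)\<^sup>2 / 2 + ln (D z)) / m)
       = G (S z) - (z\<^sup>2 / 2 - (S z)\<^sup>2 / 2 + ln (D z)) / m" using mpos(3) by (simp add: field_simps)
    ultimately have "- ((- m * G (S z) + z\<^sup>2 / 2 - (S z)\<^sup>2 / 2 + ln (D z)) / m) \<le>
        (1 - s) * (normal_cgf G0 (- m0) + (- ((z * (S0 z - z) - (D0 z - 1)) / m0) - u0\<^sup>2 / 2 / m0 - p (D0 z) / m0)) +
        s * (normal_cgf G1 (- m1) + (- ((z * (S1 z - z) - (D1 z - 1)) / m1) - u1\<^sup>2 / 2 / m1 - p (D1 z) / m1)) -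
        (- ((z * (S z - z) - (D z - 1)) / m) - u\<^sup>2 / 2 / m - p (D z) / m)"
      unfolding S0(5) S1(5) E u_u0_u1_def by linarith
    thus ?thesis using quad pp by (simp only: distrib_left right_diff_distrib mult_minus_right)
  qed
  have "normal_cgf G (- m) = - (ln (\<integral>x. exp (- m * G x) * ?\<phi> x \<partial>lborel) / m)" by (simp add: normal_cgf_def)
  also have "\<dots> \<le> - ((\<integral>z. (- m * G (S z) + z\<^sup>2 / 2 - (S z)\<^sup>2 / 2 + ln (D z)) * ?\<phi> z \<partial>lborel) / m)"
    using J(2) mpos(3) by (simp add: divide_right_mono)
  also have "\<dots> = (\<integral>z. - ((- m * G (S z) + z\<^sup>2 / 2 - (S z)\<^sup>2 / 2 + ln (D z)) / m) * ?\<phi> z \<partial>lborel)"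
    using J(1) by simp
  also have "\<dots> \<le> (\<integral>z. ((1 - s) * normal_cgf G0 (- m0) + s * normal_cgf G1 (- m1)) * ?\<phi> z +
      (1 / m * ?N S D z - (1 - s) / m0 * ?N S0 D0 z - s / m1 * ?N S1 D1 z) \<partial>lborel)"
  proof (rule integral_mono)
    show "integrable lborel (\<lambda>z. - ((- m * G (S z) + z\<^sup>2 / 2 - (S z)\<^sup>2 / 2 + ln (D z)) / m) * ?\<phi> z)"
      using integrable_mult_right[OF J(1), of "- 1 / m"] by simp
    show "integrable lborel (\<lambda>z. ((1 - s) * normal_cgf G0 (- m0) + s * normal_cgf G1 (- m1)) * ?\<phi> z +
      (1 / m * ?N S D z - (1 - s) / m0 * ?N S0 D0 z - s / m1 * ?N S1 D1 z))"
      by (intro Bochner_Integration.integrable_add Bochner_Integration.integrable_diff integrable_mult_right I I0 I1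
          std_normal_integral_const)
    show "- ((- m * G (S z) + z\<^sup>2 / 2 - (S z)\<^sup>2 / 2 + ln (D z)) / m) * ?\<phi> z
      \<le> ((1 - s) * normal_cgf G0 (- m0) + s * normal_cgf G1 (- m1)) * ?\<phi> z +
      (1 / m * ?N S D z - (1 - s) / m0 * ?N S0 D0 z - s / m1 * ?N S1 D1 z)" for z
    proof -
      have eq: "(c + (a / m - (1 - s) * (a0 / m0) - s * (a1 / m1))) * f
          = c * f + (1 / m * (a * f) - (1 - s) / m0 * (a0 * f) - s / m1 * (a1 * f))" for c a a0 a1 f
        by (simp add: algebra_simps)
      show ?thesis using mult_right_mono[OF pw[of z], of "?\<phi> z"] unfolding eq by simp
    qed
  qed
  also have "\<dots> = (1 - s) * normal_cgf G0 (- m0) + s * normal_cgf G1 (- m1)"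
    by (subst Bochner_Integration.integral_add Bochner_Integration.integral_diff;
        (intro Bochner_Integration.integrable_add Bochner_Integration.integrable_diff integrable_mult_right I I0 I1
          std_normal_integral_const)?)+ (simp add: I I0 I1)
  finally show ?thesis unfolding ml(1) unfolding ml(2,3) .
qed

section \<open>Tensorization\<close>

abbreviation gaussian_product :: "'n set \<Rightarrow> ('n \<Rightarrow> real) measure" where
  "gaussian_product J \<equiv> PiM J (\<lambda>_. std_normal_distribution)"

text \<open>Padding with zeros embeds every partial product into the same space, so the induction on
  \<open>J\<close> can always work with functions on the full space.\<close>

definition coords :: "'n::finite set \<Rightarrow> ('n \<Rightarrow> real) \<Rightarrow> real ^ 'n" where
  "coords J w = (\<chi> i. if i \<in> J then w i else 0)"

text \<open>Joint convexity in the space variable and the parameter is what survives integrating out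
  one coordinate at a time; convexity in the parameter alone would not.\<close>

definition lipschitz_jointly_convex ::
    "real set \<Rightarrow> real \<Rightarrow> ('b::real_normed_vector \<Rightarrow> real \<Rightarrow> real) \<Rightarrow> bool" where
  "lipschitz_jointly_convex \<Lambda> K G \<longleftrightarrow>
     convex_on (UNIV \<times> \<Lambda>) (\<lambda>(x, l). G x l) \<and> (\<forall>l\<in>\<Lambda>. K-lipschitz_on UNIV (\<lambda>x. G x l))"

lemma lipschitz_jointly_convexD:
  assumes "lipschitz_jointly_convex \<Lambda> K G" and "l0 \<in> \<Lambda>" "l1 \<in> \<Lambda>" "0 \<le> s" "s \<le> 1"
  shows "G ((1 - s) *\<^sub>R x0 + s *\<^sub>R x1) ((1 - s) * l0 + s * l1) \<le> (1 - s) * G x0 l0 + s * G x1 l1"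
  using convex_onD[of "UNIV \<times> \<Lambda>" "\<lambda>(x, l). G x l" s "(x0, l0)" "(x1, l1)"] assms
  by (simp add: lipschitz_jointly_convex_def scaleR_Pair add_Pair)

definition coord_cgf :: "'b \<Rightarrow> ('b::real_normed_vector \<Rightarrow> real \<Rightarrow> real) \<Rightarrow> 'b \<Rightarrow> real \<Rightarrow> real" where
  "coord_cgf e G x l = normal_cgf (\<lambda>y. G (x + y *\<^sub>R e) l) l"

lemma lipschitz_on_line:
  fixes G :: "'b::real_normed_vector \<Rightarrow> real"
  assumes G: "K-lipschitz_on UNIV G" and e: "norm e = 1"
  shows "K-lipschitz_on UNIV (\<lambda>y. G (x + y *\<^sub>R e))"
proof (rule lipschitz_onI)
  fix y z :: real
  have "dist (G (x + y *\<^sub>R e)) (G (x + z *\<^sub>R e)) \<le> K * dist (x + y *\<^sub>R e) (x + z *\<^sub>R e)"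
    by (rule lipschitz_onD[OF G]) auto
  also have "dist (x + y *\<^sub>R e) (x + z *\<^sub>R e) = dist y z"
    using e by (simp add: dist_norm scaleR_diff_left[symmetric])
  finally show "dist (G (x + y *\<^sub>R e)) (G (x + z *\<^sub>R e)) \<le> K * dist y z" .
qed (use lipschitz_on_nonneg[OF G] in auto)

lemma exp_normal_cgf:
  assumes G: "K-lipschitz_on UNIV G" and l: "l \<noteq> 0"
  shows "exp (l * normal_cgf G l) = (\<integral>x. exp (l * G x) * std_normal_density x \<partial>lborel)"
proof -
  have "(\<integral>x. exp (l * G x) * std_normal_density x \<partial>lborel) > 0"
    by (rule integral_exp_std_normal_pos[OF integrable_exp_lipschitz_std_normal[OF lipschitz_on_cmult_real[OF G]]])
  thus ?thesis using l by (simp add: normal_cgf_def)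
qed

text \<open>A perturbation by at most \<open>d\<close> changes the integral by a factor of at most
  \<open>exp (\<bar>l\<bar> * d)\<close>. This nonexpansiveness in the uniform distance is what
  keeps the Lipschitz constant unchanged.\<close>

lemma normal_cgf_le_add:
  assumes G: "K-lipschitz_on UNIV G" "K-lipschitz_on UNIV H" and l: "l \<noteq> 0"
    and close: "\<And>y. \<bar>G y - H y\<bar> \<le> d"
  shows "\<bar>normal_cgf G l - normal_cgf H l\<bar> \<le> d"
proof -
  have int: "integrable lborel (\<lambda>x. exp (l * A x) * std_normal_density x)" if "K-lipschitz_on UNIV A" for A
    by (rule integrable_exp_lipschitz_std_normal[OF lipschitz_on_cmult_real[OF that]])
  have *: "l * normal_cgf A l \<le> l * normal_cgf B l + \<bar>l\<bar> * d"
    if AB: "K-lipschitz_on UNIV A" "K-lipschitz_on UNIV B" "\<And>y. \<bar>A y - B y\<bar> \<le> d" for A B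
  proof -
    have "exp (l * normal_cgf A l) = (\<integral>x. exp (l * A x) * std_normal_density x \<partial>lborel)"
      by (rule exp_normal_cgf[OF AB(1) l])
    also have "\<dots> \<le> (\<integral>x. exp (\<bar>l\<bar> * d) * (exp (l * B x) * std_normal_density x) \<partial>lborel)"
    proof (rule integral_mono)
      fix x
      have "l * (A x - B x) \<le> \<bar>l\<bar> * \<bar>A x - B x\<bar>" by (metis abs_ge_self abs_mult)
      also have "\<dots> \<le> \<bar>l\<bar> * d" by (intro mult_left_mono AB) auto
      finally have "exp (l * A x) \<le> exp (\<bar>l\<bar> * d) * exp (l * B x)"
        by (simp add: exp_add[symmetric] algebra_simps)
      thus "exp (l * A x) * std_normal_density x \<le> exp (\<bar>l\<bar> * d) * (exp (l * B x) * std_normal_density x)"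
        by (simp add: mult.assoc[symmetric] mult_right_mono)
    qed (use int AB in auto)
    also have "\<dots> = exp (\<bar>l\<bar> * d + l * normal_cgf B l)"
      by (simp add: exp_add exp_normal_cgf[OF AB(2) l])
    finally show ?thesis by simp
  qed
  have "\<bar>l\<bar> * \<bar>normal_cgf G l - normal_cgf H l\<bar> = \<bar>l * normal_cgf G l - l * normal_cgf H l\<bar>" by (simp add: abs_mult[symmetric] right_diff_distrib)
  also have "\<dots> \<le> \<bar>l\<bar> * d"
    using *[OF G close] *[OF G(2,1)] close by (simp add: abs_minus_commute abs_le_iff)
  finally show ?thesis using l by simp
qed

text \<open>Joint convexity, applied to points on the lines through \<open>x0\<close> and
  \<open>x1\<close> in direction \<open>e\<close>, is the hypothesis \<open>le\<close> of the
  one-dimensional inequalities. Moving the base point changes the function on the line by at most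
  \<open>K * dist x z\<close>.\<close>

lemma lipschitz_jointly_convex_coord_cgf:
  fixes G :: "'b::real_normed_vector \<Rightarrow> real \<Rightarrow> real"
  assumes G: "lipschitz_jointly_convex \<Lambda> K G" and e: "norm e = 1" and \<Lambda>: "\<Lambda> = {0<..} \<or> \<Lambda> = {..<0}"
  shows "lipschitz_jointly_convex \<Lambda> K (coord_cgf e G)"
proof -
  have lip: "K-lipschitz_on UNIV (\<lambda>x. G x l)" if "l \<in> \<Lambda>" for l
    using G that by (auto simp: lipschitz_jointly_convex_def)
  have conv: "convex_on UNIV (\<lambda>y. G (x + y *\<^sub>R e) l)" if l: "l \<in> \<Lambda>" for x l
  proof (rule convex_onI)
    fix t y z :: real assume t: "0 < t" "t < 1"
    have "G ((1 - t) *\<^sub>R (x + y *\<^sub>R e) + t *\<^sub>R (x + z *\<^sub>R e)) ((1 - t) * l + t * l)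
        \<le> (1 - t) * G (x + y *\<^sub>R e) l + t * G (x + z *\<^sub>R e) l"
      using lipschitz_jointly_convexD[OF G l l, of t] t by simp
    also have "(1 - t) *\<^sub>R (x + y *\<^sub>R e) + t *\<^sub>R (x + z *\<^sub>R e) = x + ((1 - t) *\<^sub>R y + t *\<^sub>R z) *\<^sub>R e"
      by (simp add: algebra_simps)
    also have "(1 - t) * l + t * l = l" by (simp add: algebra_simps)
    finally show "G (x + ((1 - t) *\<^sub>R y + t *\<^sub>R z) *\<^sub>R e) l \<le> (1 - t) * G (x + y *\<^sub>R e) l + t * G (x + z *\<^sub>R e) l" .
  qed simp
  have "convex \<Lambda>" using \<Lambda> by auto
  hence "convex_on (UNIV \<times> \<Lambda>) (\<lambda>(x, l). coord_cgf e G x l)"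
  proof (intro convex_onI)
    fix s :: real and p q :: "'b \<times> real"
    assume s: "0 < s" "s < 1" and pq: "p \<in> UNIV \<times> \<Lambda>" "q \<in> UNIV \<times> \<Lambda>"
    obtain x0 l0 x1 l1 where p: "p = (x0, l0)" "q = (x1, l1)" by fastforce
    have l: "l0 \<in> \<Lambda>" "l1 \<in> \<Lambda>" using pq p by auto
    define xs where "xs = (1 - s) *\<^sub>R x0 + s *\<^sub>R x1"
    define ls where "ls = (1 - s) * l0 + s * l1"
    have ls: "ls \<in> \<Lambda>" unfolding ls_def using convexD[OF \<open>convex \<Lambda>\<close> l, of "1 - s" s] s by simp
    have le: "G (xs + ((1 - s) * y + s * z) *\<^sub>R e) ls \<le> (1 - s) * G (x0 + y *\<^sub>R e) l0 + s * G (x1 + z *\<^sub>R e) l1" for y z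
    proof -
      have "(1 - s) *\<^sub>R (x0 + y *\<^sub>R e) + s *\<^sub>R (x1 + z *\<^sub>R e) = xs + ((1 - s) * y + s * z) *\<^sub>R e"
        by (simp add: xs_def algebra_simps)
      thus ?thesis using lipschitz_jointly_convexD[OF G l, of s "x0 + y *\<^sub>R e" "x1 + z *\<^sub>R e"] s
        by (simp add: ls_def)
    qed
    have "coord_cgf e G xs ls \<le> (1 - s) * coord_cgf e G x0 l0 + s * coord_cgf e G x1 l1"
      using \<Lambda>
    proof
      assume "\<Lambda> = {0<..}"
      thus ?thesis unfolding coord_cgf_def ls_def
        by (intro normal_cgf_convex_pos[where K = K] lipschitz_on_line e lip s conv le[unfolded ls_def])
          (use l ls in \<open>auto simp: ls_def\<close>)
    next
      assume "\<Lambda> = {..<0}"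
      thus ?thesis unfolding coord_cgf_def ls_def
        by (intro normal_cgf_convex_neg[where K = K] lipschitz_on_line e lip s conv le[unfolded ls_def])
          (use l ls in \<open>auto simp: ls_def\<close>)
    qed
    thus "(case (1 - s) *\<^sub>R p + s *\<^sub>R q of (x, l) \<Rightarrow> coord_cgf e G x l)
        \<le> (1 - s) * (case p of (x, l) \<Rightarrow> coord_cgf e G x l) + s * (case q of (x, l) \<Rightarrow> coord_cgf e G x l)"
      by (simp add: p xs_def ls_def scaleR_Pair add_Pair)
  qed (simp add: convex_Times)
  moreover have "K-lipschitz_on UNIV (\<lambda>x. coord_cgf e G x l)" if l: "l \<in> \<Lambda>" for l
  proof (rule lipschitz_onI)
    have l0: "l \<noteq> 0" using l \<Lambda> by auto
    fix x z :: 'b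
    have "\<bar>G (x + y *\<^sub>R e) l - G (z + y *\<^sub>R e) l\<bar> \<le> K * dist x z" for y
      using lipschitz_onD[OF lip[OF l], of "x + y *\<^sub>R e" "z + y *\<^sub>R e"] by (simp add: dist_real_def)
    from normal_cgf_le_add[OF lipschitz_on_line[OF lip[OF l] e] lipschitz_on_line[OF lip[OF l] e] l0 this]
    show "dist (coord_cgf e G x l) (coord_cgf e G z l) \<le> K * dist x z"
      by (simp add: coord_cgf_def dist_real_def)
  qed (use lipschitz_on_nonneg[OF lip[OF l]] in auto)
  ultimately show ?thesis by (simp add: lipschitz_jointly_convex_def)
qed

section \<open>Finite products of the Gaussian measure\<close>

lemma integral_std_normal_distribution:
  fixes f :: "real \<Rightarrow> real"
  assumes "f \<in> borel_measurable borel"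
  shows "(\<integral>y. f y \<partial>std_normal_distribution) = (\<integral>y. f y * std_normal_density y \<partial>lborel)"
  using assms by (subst integral_density) (auto simp: mult.commute)

lemma integrable_std_normal_distribution:
  fixes f :: "real \<Rightarrow> real"
  assumes "f \<in> borel_measurable borel"
  shows "integrable std_normal_distribution f \<longleftrightarrow> integrable lborel (\<lambda>y. f y * std_normal_density y)"
  using assms by (subst integrable_density) (auto simp: mult.commute)

lemma product_prob_space_std_normal: "product_prob_space (\<lambda>_. std_normal_distribution)"
  by (intro product_prob_spaceI prob_space_normal_density) simp

lemma coords_measurable [measurable]:
  fixes J :: "'n::finite set"
  shows "coords J \<in> borel_measurable (gaussian_product J)"
proof (subst borel_measurable_euclidean_space, rule ballI)
  fix b :: "real ^ 'n" assume "b \<in> Basis"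
  then obtain i where b: "b = axis i 1" by (auto simp: Basis_vec_def)
  have "(\<lambda>w. if i \<in> J then w i else 0) \<in> borel_measurable (gaussian_product J)"
    by (cases "i \<in> J") auto
  thus "(\<lambda>w. coords J w \<bullet> b) \<in> borel_measurable (gaussian_product J)"
    by (simp add: b coords_def inner_axis)
qed

lemma norm_coords_le: "norm (coords J w) \<le> (\<Sum>i\<in>J. \<bar>w i\<bar>)"
proof -
  have "norm (coords J w) \<le> (\<Sum>i\<in>UNIV. \<bar>coords J w $ i\<bar>)" by (rule norm_le_l1_cart)
  also have "\<dots> = (\<Sum>i\<in>UNIV. if i \<in> J then \<bar>w i\<bar> else 0)"
    by (intro sum.cong) (auto simp: coords_def)
  also have "\<dots> = (\<Sum>i\<in>J. \<bar>w i\<bar>)" by (simp add: sum.If_cases)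
  finally show ?thesis .
qed

text \<open>The norm is at most the sum of the absolute coordinates, and the exponential of that sum
  factors over the coordinates.\<close>

lemma integrable_exp_norm_coords:
  assumes c: "c \<ge> 0"
  shows "integrable (gaussian_product J) (\<lambda>w. exp (c * norm (coords J w)))"
proof -
  interpret product_prob_space "\<lambda>_::'a. std_normal_distribution" by (rule product_prob_space_std_normal)
  show ?thesis
  proof (rule Bochner_Integration.integrable_bound)
    show "integrable (gaussian_product J) (\<lambda>w. \<Prod>i\<in>J. exp (c * \<bar>w i\<bar>))"
      by (intro product_integrable_prod)
        (auto simp: integrable_std_normal_distribution intro: integrable_exp_abs_std_normal)
    show "AE w in gaussian_product J. norm (exp (c * norm (coords J w))) \<le> norm (\<Prod>i\<in>J. exp (c * \<bar>w i\<bar>))"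
    proof (rule AE_I2)
      fix w :: "'a \<Rightarrow> real"
      have "c * norm (coords J w) \<le> (\<Sum>i\<in>J. c * \<bar>w i\<bar>)"
        using mult_left_mono[OF norm_coords_le c] by (simp add: sum_distrib_left)
      thus "norm (exp (c * norm (coords J w))) \<le> norm (\<Prod>i\<in>J. exp (c * \<bar>w i\<bar>))"
        by (simp add: exp_sum[symmetric] abs_prod)
    qed
  qed measurable
qed

lemma integrable_exp_lipschitz_coords:
  fixes G :: "real ^ 'n \<Rightarrow> real"
  assumes G: "K-lipschitz_on UNIV G"
  shows "integrable (gaussian_product J) (\<lambda>w. exp (l * G (x + coords J w)))"
proof (rule Bochner_Integration.integrable_bound)
  have K: "K \<ge> 0" by (rule lipschitz_on_nonneg[OF G])
  thus "integrable (gaussian_product J) (\<lambda>w. exp \<bar>l * G x\<bar> * exp ((\<bar>l\<bar> * K) * norm (coords J w)))"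
    by (intro integrable_mult_right integrable_exp_norm_coords) simp
  note [measurable] = lipschitz_on_borel_measurable[OF G]
  show "(\<lambda>w. exp (l * G (x + coords J w))) \<in> borel_measurable (gaussian_product J)" by measurable
  show "AE w in gaussian_product J. norm (exp (l * G (x + coords J w)))
      \<le> norm (exp \<bar>l * G x\<bar> * exp ((\<bar>l\<bar> * K) * norm (coords J w)))"
  proof (rule AE_I2)
    fix w
    have "\<bar>G (x + coords J w) - G x\<bar> \<le> K * norm (coords J w)"
      using lipschitz_onD[OF G, of "x + coords J w" x] by (simp add: dist_norm)
    hence "\<bar>l\<bar> * \<bar>G (x + coords J w) - G x\<bar> \<le> \<bar>l\<bar> * K * norm (coords J w)"
      by (simp add: mult.assoc mult_left_mono)
    hence "l * G (x + coords J w) \<le> \<bar>l * G x\<bar> + \<bar>l\<bar> * K * norm (coords J w)"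
      unfolding abs_mult[symmetric] right_diff_distrib by linarith
    thus "norm (exp (l * G (x + coords J w))) \<le> norm (exp \<bar>l * G x\<bar> * exp ((\<bar>l\<bar> * K) * norm (coords J w)))"
      by (simp add: exp_add[symmetric])
  qed
qed

definition product_cgf :: "'n::finite set \<Rightarrow> (real ^ 'n \<Rightarrow> real \<Rightarrow> real) \<Rightarrow> real ^ 'n \<Rightarrow> real \<Rightarrow> real" where
  "product_cgf J G x l = ln (\<integral>w. exp (l * G (x + coords J w) l) \<partial>gaussian_product J) / l"

text \<open>Fubini: the inner integral is \<open>exp (l * coord_cgf ...)\<close> with the same
  \<open>l\<close>, so the logarithm and the division cancel between the layers and
  \<open>coord_cgf\<close> takes the place of \<open>G\<close>.\<close>

lemma product_cgf_insert:
  fixes G :: "real ^ 'n \<Rightarrow> real \<Rightarrow> real"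
  assumes i: "i \<notin> J" and G: "K-lipschitz_on UNIV (\<lambda>x. G x l)" and l: "l \<noteq> 0"
  shows "product_cgf (insert i J) G x l = product_cgf J (coord_cgf (axis i 1) G) x l"
proof -
  interpret product_prob_space "\<lambda>_::'n. std_normal_distribution" by (rule product_prob_space_std_normal)
  note [measurable] = lipschitz_on_borel_measurable[OF G]
  have upd: "coords (insert i J) (w(i := y)) = coords J w + y *\<^sub>R axis i 1" for w y
    using i by (auto simp: coords_def vec_eq_iff axis_def)
  have "(\<integral>w. exp (l * G (x + coords (insert i J) w) l) \<partial>gaussian_product (insert i J))
      = (\<integral>w. (\<integral>y. exp (l * G (x + coords (insert i J) (w(i := y))) l) \<partial>std_normal_distribution) \<partial>gaussian_product J)"
    by (rule product_integral_insert[OF _ i integrable_exp_lipschitz_coords[OF G]]) simp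
  also have "\<dots> = (\<integral>w. exp (l * coord_cgf (axis i 1) G (x + coords J w) l) \<partial>gaussian_product J)"
  proof (rule Bochner_Integration.integral_cong)
    fix w
    have "(\<integral>y. exp (l * G (x + coords (insert i J) (w(i := y))) l) \<partial>std_normal_distribution)
        = (\<integral>y. exp (l * G (x + coords J w + y *\<^sub>R axis i 1) l) * std_normal_density y \<partial>lborel)"
      unfolding upd by (subst integral_std_normal_distribution) (auto simp: add.assoc)
    also have "\<dots> = exp (l * coord_cgf (axis i 1) G (x + coords J w) l)"
      unfolding coord_cgf_def by (rule exp_normal_cgf[symmetric, OF lipschitz_on_line[OF G] l]) simp
    finally show "(\<integral>y. exp (l * G (x + coords (insert i J) (w(i := y))) l) \<partial>std_normal_distribution)
        = exp (l * coord_cgf (axis i 1) G (x + coords J w) l)" .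
  qed simp
  finally show ?thesis by (simp add: product_cgf_def)
qed

lemma product_cgf_empty:
  fixes G :: "real ^ 'n \<Rightarrow> real \<Rightarrow> real"
  assumes "l \<noteq> 0"
  shows "product_cgf {} G x l = G x l"
proof -
  have "coords {} w = 0" for w :: "'n \<Rightarrow> real" by (simp add: coords_def vec_eq_iff)
  thus ?thesis using assms
    by (simp add: product_cgf_def PiM_empty lebesgue_integral_count_space_finite)
qed

text \<open>The identities for \<open>product_cgf\<close> hold for nonzero \<open>l\<close> only,
  hence on \<open>\<Lambda>\<close> but not as equations between functions.\<close>

lemma lipschitz_jointly_convex_cong:
  assumes "\<And>x l. l \<in> \<Lambda> \<Longrightarrow> G x l = H x l"
  shows "lipschitz_jointly_convex \<Lambda> K G \<longleftrightarrow> lipschitz_jointly_convex \<Lambda> K H"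
proof -
  have "K-lipschitz_on UNIV (\<lambda>x. G x l) \<longleftrightarrow> K-lipschitz_on UNIV (\<lambda>x. H x l)" if "l \<in> \<Lambda>" for l
    using assms[OF that] by simp
  moreover have "convex_on (UNIV \<times> \<Lambda>) (\<lambda>(x, l). G x l) \<longleftrightarrow> convex_on (UNIV \<times> \<Lambda>) (\<lambda>(x, l). H x l)"
  proof -
    have "convex_on (UNIV \<times> \<Lambda>) (\<lambda>(x, l). B x l)"
      if AB: "convex_on (UNIV \<times> \<Lambda>) (\<lambda>(x, l). A x l)" "\<And>x l. l \<in> \<Lambda> \<Longrightarrow> B x l = A x l" for A B :: "'a \<Rightarrow> real \<Rightarrow> real"
    proof (rule convex_onI)
      have cv: "convex (UNIV \<times> \<Lambda> :: ('a \<times> real) set)" using AB(1) by (rule convex_on_imp_convex)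
      show "convex (UNIV \<times> \<Lambda> :: ('a \<times> real) set)" by (rule cv)
      fix t :: real and p q :: "'a \<times> real" assume t: "0 < t" "t < 1" and pq: "p \<in> UNIV \<times> \<Lambda>" "q \<in> UNIV \<times> \<Lambda>"
      have r: "(1 - t) *\<^sub>R p + t *\<^sub>R q \<in> UNIV \<times> \<Lambda>" using convexD[OF cv pq, of "1 - t" t] t by simp
      have eq: "(case r of (x, l) \<Rightarrow> B x l) = (case r of (x, l) \<Rightarrow> A x l)" if "r \<in> UNIV \<times> \<Lambda>" for r
        using that AB(2) by auto
      show "(case (1 - t) *\<^sub>R p + t *\<^sub>R q of (x, l) \<Rightarrow> B x l)
          \<le> (1 - t) * (case p of (x, l) \<Rightarrow> B x l) + t * (case q of (x, l) \<Rightarrow> B x l)"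
        unfolding eq[OF r] eq[OF pq(1)] eq[OF pq(2)] using convex_onD[OF AB(1) _ _ pq, of t] t by simp
    qed
    from this[of G H] this[of H G] show ?thesis using assms by auto
  qed
  ultimately show ?thesis by (simp add: lipschitz_jointly_convex_def)
qed

text \<open>The induction must let \<open>G\<close> vary: integrating out a coordinate makes the
  function depend on the parameter even if it did not before.\<close>

lemma lipschitz_jointly_convex_product_cgf:
  fixes G :: "real ^ 'n \<Rightarrow> real \<Rightarrow> real" and J :: "'n set"
  assumes G: "lipschitz_jointly_convex \<Lambda> K G" and \<Lambda>: "\<Lambda> = {0<..} \<or> \<Lambda> = {..<0}"
  shows "lipschitz_jointly_convex \<Lambda> K (product_cgf J G)"
  using finite[of J] G
proof (induction J arbitrary: G rule: finite_induct)
  case empty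
  have "product_cgf {} G x l = G x l" if "l \<in> \<Lambda>" for x l
    using that \<Lambda> by (intro product_cgf_empty) auto
  thus ?case using empty by (subst lipschitz_jointly_convex_cong[where H = G])
next
  case (insert i J)
  have "product_cgf (insert i J) G x l = product_cgf J (coord_cgf (axis i 1) G) x l" if "l \<in> \<Lambda>" for x l
    using that \<Lambda> insert.hyps insert.prems
    by (intro product_cgf_insert[where K = K]) (auto simp: lipschitz_jointly_convex_def)
  moreover have "lipschitz_jointly_convex \<Lambda> K (product_cgf J (coord_cgf (axis i 1) G))"
    by (intro insert.IH lipschitz_jointly_convex_coord_cgf insert.prems \<Lambda>) simp
  ultimately show ?case by (subst lipschitz_jointly_convex_cong)
qed

lemma convex_on_product_cgf:
  fixes F :: "real ^ 'n \<Rightarrow> real"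
  assumes F: "convex_on UNIV F" "K-lipschitz_on UNIV F" and \<Lambda>: "\<Lambda> = {0<..} \<or> \<Lambda> = {..<0}"
  shows "convex_on \<Lambda> (\<lambda>l. ln (\<integral>w. exp (l * F (coords UNIV w)) \<partial>gaussian_product UNIV) / l)"
proof (rule convex_onI)
  show cv: "convex \<Lambda>" using \<Lambda> by auto
  have "lipschitz_jointly_convex \<Lambda> K (\<lambda>x l. F x)"
    unfolding lipschitz_jointly_convex_def
  proof (intro conjI ballI convex_onI)
    show "convex (UNIV \<times> \<Lambda> :: ((real ^ 'n) \<times> real) set)" using cv by (simp add: convex_Times)
    fix t :: real and p q :: "(real ^ 'n) \<times> real" assume t: "0 < t" "t < 1"
    show "(case (1 - t) *\<^sub>R p + t *\<^sub>R q of (x, l) \<Rightarrow> F x) \<le> (1 - t) * (case p of (x, l) \<Rightarrow> F x) + t * (case q of (x, l) \<Rightarrow> F x)"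
      using convex_onD[OF F(1), of t "fst p" "fst q"] t by (simp add: case_prod_unfold)
  qed (rule F)
  hence jc: "lipschitz_jointly_convex \<Lambda> K (product_cgf UNIV (\<lambda>x l. F x))"
    using \<Lambda> by (rule lipschitz_jointly_convex_product_cgf)
  fix t l0 l1 :: real assume t: "0 < t" "t < 1" and l: "l0 \<in> \<Lambda>" "l1 \<in> \<Lambda>"
  show "ln (\<integral>w. exp (((1 - t) *\<^sub>R l0 + t *\<^sub>R l1) * F (coords UNIV w)) \<partial>gaussian_product UNIV) / ((1 - t) *\<^sub>R l0 + t *\<^sub>R l1)
      \<le> (1 - t) * (ln (\<integral>w. exp (l0 * F (coords UNIV w)) \<partial>gaussian_product UNIV) / l0)
        + t * (ln (\<integral>w. exp (l1 * F (coords UNIV w)) \<partial>gaussian_product UNIV) / l1)"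
    using lipschitz_jointly_convexD[OF jc l, of t 0 0] t by (simp add: product_cgf_def)
qed

section \<open>Lipschitz envelopes\<close>

text \<open>On the unit sphere around \<open>x\<close> the function is bounded above by compactness.
  A steep descent from \<open>x\<close> towards \<open>y\<close> would force a large value at the
  opposite point of the sphere.\<close>

lemma convex_on_linear_minorant:
  fixes F :: "'b::euclidean_space \<Rightarrow> real"
  assumes F: "convex_on UNIV F"
  shows "\<exists>M\<ge>0. \<forall>y. F y \<ge> F x - M * dist x y"
proof -
  have cont: "continuous_on UNIV F" using convex_on_continuous[OF open_UNIV F] .
  have "compact (F ` sphere x 1)"
    by (intro compact_continuous_image continuous_on_subset[OF cont]) auto
  hence "bounded (F ` sphere x 1)" by (rule compact_imp_bounded)
  then obtain C where C': "\<forall>v\<in>F ` sphere x 1. norm v \<le> C"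
    unfolding bounded_iff by (rule exE)
  have C: "F u \<le> C" if "u \<in> sphere x 1" for u
    using bspec[OF C' imageI[OF that]] by simp
  define M where "M = max 0 (C - F x)"
  have "F y \<ge> F x - M * dist x y" for y
  proof (cases "x = y")
    case False
    define d where "d = dist x y"
    have d: "d > 0" using False by (simp add: d_def)
    \<comment> \<open>The sphere point opposite to \<open>y\<close>. The weight
      \<open>t = 1 / (1 + d)\<close> below is the one for which
      \<open>x = (1 - t) u + t y\<close>.\<close>
    define u where "u = x - (1 / d) *\<^sub>R (y - x)"
    have "u \<in> sphere x 1" using d by (simp add: u_def dist_norm d_def norm_minus_commute)
    hence FC: "F u \<le> C" by (rule C)
    define t where "t = 1 / (1 + d)"
    have t: "0 \<le> t" "t \<le> 1" "(1 - t) * (1 / d) = t" "t * (1 + d) = 1" "t > 0" using d by (auto simp: t_def field_simps)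
    have "(1 - t) *\<^sub>R u + t *\<^sub>R y = (1 - t) *\<^sub>R x + t *\<^sub>R y - ((1 - t) * (1 / d)) *\<^sub>R (y - x)"
      by (simp add: u_def scaleR_diff_right)
    also have "\<dots> = x" unfolding t(3) by (simp add: algebra_simps)
    finally have "F x \<le> (1 - t) * F u + t * F y" using convex_onD[OF F, of t u y] t by simp
    also have "\<dots> \<le> (1 - t) * C + t * F y" using FC t by (intro add_right_mono mult_left_mono) auto
    finally have "(1 + d) * F x \<le> (1 + d) * ((1 - t) * C + t * F y)" using d by (intro mult_left_mono) auto
    also have "\<dots> = d * C + F y"
    proof -
      have "(1 + d) * (1 - t) = d" "(1 + d) * t = 1" using t(4) by (simp_all add: algebra_simps)
      thus ?thesis by (simp add: distrib_left mult.assoc[symmetric])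
    qed
    finally have "F y \<ge> F x - d * (C - F x)" by (simp add: algebra_simps)
    moreover have "d * (C - F x) \<le> M * d" using d by (simp add: M_def mult.commute)
    ultimately show ?thesis by (simp add: d_def)
  qed simp
  thus ?thesis by (intro exI[of _ M]) (simp add: M_def)
qed

text \<open>The Pasch-Hausdorff envelope, that is, the infimal convolution of \<open>F\<close> with
  \<open>k\<close> times the distance. The infimum is meaningful once \<open>k\<close> is at least
  the slope of a conical minorant, as in the context below.\<close>

definition lipschitz_envelope :: "('b::metric_space \<Rightarrow> real) \<Rightarrow> real \<Rightarrow> 'b \<Rightarrow> real" where
  "lipschitz_envelope F k x = (INF y. F y + k * dist x y)"

context
  fixes F :: "'b::euclidean_space \<Rightarrow> real" and M k :: real
  assumes F: "convex_on UNIV F" and M: "M \<ge> 0" "\<And>y. F y \<ge> F 0 - M * norm y" and k: "k \<ge> M"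
begin

lemma lipschitz_envelope_aux: "F 0 - M * norm x \<le> F y + k * dist x y"
proof -
  have "M * norm y \<le> M * (norm x + dist x y)"
    using M(1) norm_triangle_ineq2[of y x] by (intro mult_left_mono) (auto simp: dist_norm norm_minus_commute)
  also have "\<dots> \<le> M * norm x + k * dist x y" using k by (simp add: distrib_left mult_right_mono)
  finally show ?thesis using M(2)[of y] by simp
qed

lemma bdd_below_envelope: "bdd_below (range (\<lambda>y. F y + k * dist x y))"
  by (rule bdd_belowI2[of _ "F 0 - M * norm x"]) (rule lipschitz_envelope_aux)

lemma lipschitz_envelope_lower: "F 0 - M * norm x \<le> lipschitz_envelope F k x"
  unfolding lipschitz_envelope_def by (intro cINF_greatest lipschitz_envelope_aux) simp

lemma lipschitz_envelope_le: "lipschitz_envelope F k x \<le> F y + k * dist x y"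
  unfolding lipschitz_envelope_def by (intro cINF_lower bdd_below_envelope UNIV_I)

lemma lipschitz_on_envelope: "k-lipschitz_on UNIV (lipschitz_envelope F k)"
proof (rule lipschitz_onI)
  have *: "lipschitz_envelope F k x \<le> lipschitz_envelope F k z + k * dist x z" for x z
  proof -
    have "lipschitz_envelope F k x - k * dist x z \<le> lipschitz_envelope F k z"
      unfolding lipschitz_envelope_def[of F k z]
    proof (rule cINF_greatest)
      fix y
      have "k * dist x y \<le> k * (dist x z + dist z y)" using M(1) k by (intro mult_left_mono dist_triangle) auto
      thus "lipschitz_envelope F k x - k * dist x z \<le> F y + k * dist z y"
        using lipschitz_envelope_le[of x y] by (simp add: distrib_left)
    qed simp
    thus ?thesis by simp
  qed
  show "dist (lipschitz_envelope F k x) (lipschitz_envelope F k z) \<le> k * dist x z" for x z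
    using *[of x z] *[of z x] by (simp add: dist_real_def dist_commute abs_le_iff)
qed (use M k in auto)

text \<open>The expression under the infimum is jointly convex in both points. The two infima over
  \<open>a\<close> and \<open>b\<close> are taken one after the other, each time by solving the
  inequality for the term concerned.\<close>

lemma convex_on_envelope: "convex_on UNIV (lipschitz_envelope F k)"
proof (rule convex_onI)
  fix t :: real and x y :: 'b assume t: "0 < t" "t < 1"
  let ?E = "lipschitz_envelope F k"
  let ?z = "(1 - t) *\<^sub>R x + t *\<^sub>R y"
  have *: "?E ?z \<le> (1 - t) * (F a + k * dist x a) + t * (F b + k * dist y b)" for a b
  proof -
    have "dist ?z ((1 - t) *\<^sub>R a + t *\<^sub>R b) = norm ((1 - t) *\<^sub>R (x - a) + t *\<^sub>R (y - b))"
      by (simp add: dist_norm algebra_simps)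
    also have "\<dots> \<le> (1 - t) * dist x a + t * dist y b"
      using norm_triangle_ineq[of "(1 - t) *\<^sub>R (x - a)" "t *\<^sub>R (y - b)"] t by (simp add: dist_norm)
    finally have "k * dist ?z ((1 - t) *\<^sub>R a + t *\<^sub>R b) \<le> k * ((1 - t) * dist x a + t * dist y b)"
      using M(1) k by (intro mult_left_mono) auto
    moreover have "F ((1 - t) *\<^sub>R a + t *\<^sub>R b) \<le> (1 - t) * F a + t * F b"
      using convex_onD[OF F, of t a b] t by simp
    ultimately show ?thesis using lipschitz_envelope_le[of ?z "(1 - t) *\<^sub>R a + t *\<^sub>R b"]
      by (simp add: algebra_simps)
  qed
  have 1: "?E ?z \<le> (1 - t) * ?E x + t * (F b + k * dist y b)" for b
  proof -
    have "(?E ?z - t * (F b + k * dist y b)) / (1 - t) \<le> ?E x"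
      unfolding lipschitz_envelope_def[of F k x]
    proof (rule cINF_greatest)
      show "(?E ?z - t * (F b + k * dist y b)) / (1 - t) \<le> F a + k * dist x a" for a
        using *[of a b] t by (simp add: pos_divide_le_eq mult.commute)
    qed simp
    thus ?thesis using t by (simp add: pos_divide_le_eq mult.commute)
  qed
  have "(?E ?z - (1 - t) * ?E x) / t \<le> ?E y"
    unfolding lipschitz_envelope_def[of F k y]
  proof (rule cINF_greatest)
    show "(?E ?z - (1 - t) * ?E x) / t \<le> F b + k * dist y b" for b
      using 1[of b] t by (simp add: pos_divide_le_eq mult.commute)
  qed simp
  thus "?E ?z \<le> (1 - t) * ?E x + t * ?E y" using t by (simp add: pos_divide_le_eq mult.commute)
qed simp

end

text \<open>Equality holds as soon as \<open>k\<close> exceeds the slope \<open>N\<close> of a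
  minorant touching \<open>F\<close> at \<open>x\<close>; \<open>k \<ge> M\<close> keeps the infimum
  bounded below.\<close>

lemma lipschitz_envelope_eventually_eq:
  fixes F :: "'b::euclidean_space \<Rightarrow> real"
  assumes F: "convex_on UNIV F" and M: "M \<ge> 0" "\<And>y. F y \<ge> F 0 - M * norm y"
  shows "\<forall>\<^sub>F k in at_top. lipschitz_envelope F k x = F x"
proof -
  obtain N where N: "N \<ge> 0" "\<And>y. F y \<ge> F x - N * dist x y" using convex_on_linear_minorant[OF F] by blast
  show ?thesis
    using eventually_ge_at_top[of N] eventually_ge_at_top[of M]
  proof eventually_elim
    case (elim k)
    have "F x \<le> lipschitz_envelope F k x" unfolding lipschitz_envelope_def
    proof (rule cINF_greatest)
      fix y
      have "N * dist x y \<le> k * dist x y" using elim by (intro mult_right_mono) auto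
      thus "F x \<le> F y + k * dist x y" using N(2)[of y] by linarith
    qed simp
    moreover have "lipschitz_envelope F k x \<le> F x" using lipschitz_envelope_le[OF F M elim(2), of x x] by simp
    ultimately show ?case by simp
  qed
qed

section \<open>From Lipschitz to general convex functions\<close>

lemma convex_on_limit:
  fixes f :: "real \<Rightarrow> real" and fk :: "nat \<Rightarrow> real \<Rightarrow> real"
  assumes fk: "\<And>n. convex_on \<Lambda> (fk n)" and lim: "\<And>x. x \<in> \<Lambda> \<Longrightarrow> (\<lambda>n. fk n x) \<longlonglongrightarrow> f x"
  shows "convex_on \<Lambda> f"
proof (rule convex_onI)
  show cv: "convex \<Lambda>" using fk convex_on_imp_convex by blast
  fix t x y :: real assume t: "0 < t" "t < 1" and xy: "x \<in> \<Lambda>" "y \<in> \<Lambda>"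
  have z: "(1 - t) *\<^sub>R x + t *\<^sub>R y \<in> \<Lambda>" using convexD[OF cv xy, of "1 - t" t] t by simp
  show "f ((1 - t) *\<^sub>R x + t *\<^sub>R y) \<le> (1 - t) * f x + t * f y"
    by (rule LIMSEQ_le[OF lim[OF z] tendsto_add[OF tendsto_mult[OF tendsto_const lim[OF xy(1)]]
            tendsto_mult[OF tendsto_const lim[OF xy(2)]]]])
      (use convex_onD[OF fk, of t x y] t xy in auto)
qed

lemma (in prob_space) expectation_exp_pos:
  fixes X :: "'a \<Rightarrow> real"
  assumes "integrable M (\<lambda>\<omega>. exp (X \<omega>))"
  shows "expectation (\<lambda>\<omega>. exp (X \<omega>)) > 0"
proof -
  have "expectation (\<lambda>\<omega>. exp (X \<omega>)) \<noteq> 0"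
  proof
    assume "expectation (\<lambda>\<omega>. exp (X \<omega>)) = 0"
    hence "AE \<omega> in M. exp (X \<omega>) = 0" using assms by (subst (asm) integral_nonneg_eq_0_iff_AE) auto
    thus False by simp
  qed
  moreover have "expectation (\<lambda>\<omega>. exp (X \<omega>)) \<ge> 0" by (intro integral_nonneg_AE) auto
  ultimately show ?thesis by linarith
qed

lemma gaussian_cgf_convex_halves:
  fixes F :: "real ^ 'n \<Rightarrow> real"
  assumes F: "convex_on UNIV F"
    and int: "\<And>l. l > 0 \<Longrightarrow> integrable (gaussian_product UNIV) (\<lambda>w. exp (l * F (coords UNIV w)))"
  shows "integrable (gaussian_product UNIV) (\<lambda>w. exp (l * F (coords UNIV w)))"
    and "\<Lambda> = {0<..} \<or> \<Lambda> = {..<0} \<Longrightarrow> convex_on \<Lambda> (\<lambda>l. ln (\<integral>w. exp (l * F (coords UNIV w)) \<partial>gaussian_product UNIV) / l)"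
proof -
  interpret P: prob_space "gaussian_product (UNIV :: 'n set)"
    by (intro prob_space_PiM prob_space_normal_density) simp
  let ?P = "gaussian_product (UNIV :: 'n set)"
  obtain M where M: "M \<ge> 0" "\<And>y. F y \<ge> F 0 - M * norm y"
    using convex_on_linear_minorant[OF F, of 0] by auto
  have [measurable]: "F \<in> borel_measurable borel"
    using convex_on_continuous[OF open_UNIV F] by (rule borel_measurable_continuous_onI)
  \<comment> \<open>For \<open>l > 0\<close> the envelopes lie below \<open>F\<close>, which
    dominates by assumption. Otherwise \<open>F\<close> and all envelopes lie above
    \<open>F 0 - M * norm x\<close>, so one exponential of a norm dominates; this also gives
    integrability for negative \<open>l\<close>.\<close>
  have dom: "\<exists>w. integrable ?P w \<and> (\<forall>k\<ge>M. \<forall>v. exp (l * lipschitz_envelope F k (coords UNIV v)) \<le> w v) \<and>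
      (\<forall>v. exp (l * F (coords UNIV v)) \<le> w v)" for l
  proof (cases "l > 0")
    case True
    have "exp (l * lipschitz_envelope F k (coords UNIV v)) \<le> exp (l * F (coords UNIV v))" if "k \<ge> M" for k and v :: "'n \<Rightarrow> real"
      using lipschitz_envelope_le[OF F M that, of "coords UNIV v" "coords UNIV v"] True by simp
    thus ?thesis using int[OF True] by (intro exI[of _ "\<lambda>v. exp (l * F (coords UNIV v))"]) auto
  next
    case False
    have low: "exp (l * y) \<le> exp (l * F 0) * exp ((\<bar>l\<bar> * M) * norm x)" if "F 0 - M * norm x \<le> y" for x :: "real ^ 'n" and y
      using mult_left_mono_neg[OF that, of l] False by (simp add: exp_add[symmetric] algebra_simps)
    show ?thesis
    proof (intro exI conjI allI impI)
      show "integrable ?P (\<lambda>v. exp (l * F 0) * exp ((\<bar>l\<bar> * M) * norm (coords UNIV v)))"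
        using M by (intro integrable_mult_right integrable_exp_norm_coords) simp
    qed (intro low lipschitz_envelope_lower[OF F M] M; assumption)+
  qed
  show int': "integrable ?P (\<lambda>w. exp (l * F (coords UNIV w)))" for l
  proof -
    obtain w where w: "integrable ?P w" "\<And>v. exp (l * F (coords UNIV v)) \<le> w v" using dom[of l] by blast
    show ?thesis
    proof (rule Bochner_Integration.integrable_bound[OF w(1)])
      show "AE v in ?P. norm (exp (l * F (coords UNIV v))) \<le> norm (w v)"
        using w(2) by (intro AE_I2) (simp, meson abs_ge_self order_trans)
    qed measurable
  qed
  assume \<Lambda>: "\<Lambda> = {0<..} \<or> \<Lambda> = {..<0}"
  define k where "k n = M + real n" for n
  have kM: "k n \<ge> M" for n by (simp add: k_def)
  have ktop: "filterlim k at_top sequentially"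
    unfolding k_def[abs_def] by (intro filterlim_tendsto_add_at_top[OF tendsto_const] filterlim_real_sequentially)
  show "convex_on \<Lambda> (\<lambda>l. ln (\<integral>w. exp (l * F (coords UNIV w)) \<partial>?P) / l)"
  proof (rule convex_on_limit)
    show "convex_on \<Lambda> (\<lambda>l. ln (\<integral>w. exp (l * lipschitz_envelope F (k n) (coords UNIV w)) \<partial>?P) / l)" for n
      by (rule convex_on_product_cgf[OF convex_on_envelope[OF F M kM] lipschitz_on_envelope[OF F M kM] \<Lambda>])
    fix l assume "l \<in> \<Lambda>"
    hence l: "l \<noteq> 0" using \<Lambda> by auto
    obtain w where w: "integrable ?P w" "\<And>k v. k \<ge> M \<Longrightarrow> exp (l * lipschitz_envelope F k (coords UNIV v)) \<le> w v"
      using dom[of l] by blast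
    have "(\<lambda>n. \<integral>v. exp (l * lipschitz_envelope F (k n) (coords UNIV v)) \<partial>?P) \<longlonglongrightarrow> (\<integral>v. exp (l * F (coords UNIV v)) \<partial>?P)"
    proof (rule integral_dominated_convergence[where w = w])
      show "(\<lambda>v. exp (l * lipschitz_envelope F (k n) (coords UNIV v))) \<in> borel_measurable ?P" for n
        using lipschitz_on_borel_measurable[OF lipschitz_on_envelope[OF F M kM[of n]]] by measurable
      show "AE v in ?P. (\<lambda>n. exp (l * lipschitz_envelope F (k n) (coords UNIV v))) \<longlonglongrightarrow> exp (l * F (coords UNIV v))"
      proof (intro AE_I2 tendsto_eventually)
        fix v
        have "\<forall>\<^sub>F n in sequentially. lipschitz_envelope F (k n) (coords UNIV v) = F (coords UNIV v)"
          by (rule eventually_compose_filterlim[OF lipschitz_envelope_eventually_eq[OF F M] ktop])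
        thus "\<forall>\<^sub>F n in sequentially. exp (l * lipschitz_envelope F (k n) (coords UNIV v)) = exp (l * F (coords UNIV v))"
          by eventually_elim simp
      qed
      show "AE v in ?P. norm (exp (l * lipschitz_envelope F (k n) (coords UNIV v))) \<le> w v" for n
        using w(2)[OF kM] by (intro AE_I2) simp
    qed (use w in auto)
    moreover have "(\<integral>v. exp (l * F (coords UNIV v)) \<partial>?P) > 0" by (rule P.expectation_exp_pos[OF int'])
    ultimately show "(\<lambda>n. ln (\<integral>w. exp (l * lipschitz_envelope F (k n) (coords UNIV w)) \<partial>?P) / l)
        \<longlonglongrightarrow> ln (\<integral>w. exp (l * F (coords UNIV w)) \<partial>?P) / l"
      using l by (intro tendsto_divide tendsto_ln tendsto_const) auto
  qed
qed

section \<open>Gluing at 0\<close>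

text \<open>Continuity carries the chord inequality to the endpoint 0. Chord slopes from 0 then
  increase with the endpoint, and their limit at 0 is \<open>c\<close>.\<close>

lemma convex_on_pos_extend_0:
  fixes f :: "real \<Rightarrow> real"
  assumes f: "convex_on {0<..} f" and D: "(f has_real_derivative c) (at 0)" and y: "y > 0"
  shows "0 \<le> r \<Longrightarrow> r \<le> 1 \<Longrightarrow> f (r * y) \<le> (1 - r) * f 0 + r * f y" and "f 0 + c * y \<le> f y"
proof -
  have cont: "isCont f x" if "x \<ge> 0" for x
  proof (cases "x = 0")
    case False
    have "continuous_on {0<..} f" by (rule convex_on_continuous[OF _ f]) simp
    thus ?thesis using False that by (simp add: continuous_on_eq_continuous_at)
  qed (use DERIV_isCont[OF D] in simp)
  show chord: "f (r * y) \<le> (1 - r) * f 0 + r * f y" if r: "0 \<le> r" "r \<le> 1" for r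
  proof (rule tendsto_le[OF trivial_limit_at_right_real])
    have lim: "((\<lambda>e. f (g e)) \<longlongrightarrow> f (g 0)) (at_right 0)" if "isCont g 0" "g 0 \<ge> 0" for g :: "real \<Rightarrow> real"
    proof -
      have "isCont (\<lambda>e. f (g e)) 0" using isCont_o2[OF that(1) cont[OF that(2)]] .
      thus ?thesis unfolding continuous_within by (rule filterlim_mono) (auto intro: at_le)
    qed
    show "((\<lambda>e. f ((1 - r) * e + r * y)) \<longlongrightarrow> f (r * y)) (at_right 0)"
      using lim[of "\<lambda>e. (1 - r) * e + r * y"] r y by (simp add: continuous_intros)
    show "((\<lambda>e. (1 - r) * f e + r * f y) \<longlongrightarrow> (1 - r) * f 0 + r * f y) (at_right 0)"
      using lim[of "\<lambda>e. e"] by (intro tendsto_intros) simp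
    show "\<forall>\<^sub>F e in at_right 0. f ((1 - r) * e + r * y) \<le> (1 - r) * f e + r * f y"
      unfolding eventually_at_right_field
      using convex_onD[OF f r, of _ y] y by (intro exI[of _ 1]) auto
  qed
  have "(\<lambda>h. (f (0 + h) - f 0) / h) \<midarrow>0\<rightarrow> c" using D by (simp add: DERIV_def)
  hence lim: "((\<lambda>h. (f h - f 0) / h) \<longlongrightarrow> c) (at_right 0)"
    by (simp add: filterlim_at_split)
  have "c \<le> (f y - f 0) / y"
  proof (rule tendsto_upperbound[OF lim _ trivial_limit_at_right_real])
    have "(f h - f 0) / h \<le> (f y - f 0) / y" if h: "0 < h" "h < y" for h
    proof -
      have "f h \<le> (1 - h / y) * f 0 + h / y * f y" using chord[of "h / y"] h by simp
      hence "f h - f 0 \<le> h / y * (f y - f 0)" by (simp add: algebra_simps)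
      thus ?thesis using h by (simp add: pos_divide_le_eq mult.commute)
    qed
    thus "\<forall>\<^sub>F h in at_right 0. (f h - f 0) / h \<le> (f y - f 0) / y"
      unfolding eventually_at_right_field using y by (intro exI[of _ y]) auto
  qed
  thus "f 0 + c * y \<le> f y" using y by (simp add: pos_le_divide_eq)
qed

text \<open>Two convex halves glue to a convex function as soon as a common line supports both at 0,
  which is the case if the function is differentiable there.\<close>

lemma convex_on_glue_at_0:
  fixes f :: "real \<Rightarrow> real"
  assumes pos: "convex_on {0<..} f" and neg: "convex_on {..<0} f" and D: "(f has_real_derivative c) (at 0)"
  shows "convex_on UNIV f"
proof -
  have neg': "convex_on {0<..} (\<lambda>x. f (- x))"
  proof (rule convex_onI)
    fix t x y :: real assume "0 < t" "t < 1" "x \<in> {0<..}" "y \<in> {0<..}"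
    thus "f (- ((1 - t) *\<^sub>R x + t *\<^sub>R y)) \<le> (1 - t) * f (- x) + t * f (- y)"
      using convex_onD[OF neg, of t "- x" "- y"] by (simp add: algebra_simps)
  qed simp
  have D': "((\<lambda>x. f (- x)) has_real_derivative - c) (at 0)"
  proof -
    have "((\<lambda>x::real. - x) has_real_derivative - 1) (at 0)" by (auto intro!: derivative_eq_intros)
    with D show ?thesis using DERIV_chain2[of f c "\<lambda>x. - x" 0 "-1" UNIV] by simp
  qed
  \<comment> \<open>The mean lies in the convex half and equals \<open>r * y\<close>. The chord from
    0 to \<open>y\<close> bounds it there; the support line at 0 is used at \<open>x\<close> with
    weight \<open>1 - t\<close> and at \<open>y\<close> with the remaining weight
    \<open>t - r\<close>, and its linear parts cancel.\<close>
  have glue: "h ((1 - t) * x + t * y) \<le> (1 - t) * h x + t * h y"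
    if h: "convex_on {0<..} h" "(h has_real_derivative a) (at 0)" and tangent: "h 0 + a * x \<le> h x"
      and t: "0 \<le> t" "t \<le> 1" and x: "x \<le> 0" and y: "y > 0" and z: "(1 - t) * x + t * y \<ge> 0"
    for h :: "real \<Rightarrow> real" and a t x y
  proof -
    define r where "r = ((1 - t) * x + t * y) / y"
    have ry: "r * y = (1 - t) * x + t * y" using y by (simp add: r_def)
    have "(1 - t) * x + t * y \<le> t * y" using t x by (simp add: mult_nonneg_nonpos)
    hence r: "0 \<le> r" "r \<le> t" using y z by (auto simp: r_def pos_divide_le_eq)
    have "h ((1 - t) * x + t * y) \<le> (1 - r) * h 0 + r * h y"
      using convex_on_pos_extend_0(1)[OF h y r(1)] r t by (simp add: ry)
    moreover have "(1 - t) * (h 0 + a * x) \<le> (1 - t) * h x" using tangent t by (intro mult_left_mono) auto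
    moreover have "(t - r) * (h 0 + a * y) \<le> (t - r) * h y"
      using convex_on_pos_extend_0(2)[OF h y] r by (intro mult_left_mono) auto
    moreover have "(1 - t) * (h 0 + a * x) + (t - r) * (h 0 + a * y) = (1 - r) * h 0 + a * ((1 - t) * x + t * y - r * y)"
      by (simp add: algebra_simps)
    ultimately show ?thesis unfolding ry by (simp add: algebra_simps)
  qed
  have tangent: "f 0 + c * y \<le> f y" for y
    using convex_on_pos_extend_0(2)[OF pos D, of y] convex_on_pos_extend_0(2)[OF neg' D', of "- y"]
    by (cases y "0 :: real" rule: linorder_cases) auto
  show ?thesis
  proof (rule convex_on_linorderI)
    fix t x y :: real assume t: "0 < t" "t < 1" and xy: "x < y"
    let ?z = "(1 - t) * x + t * y"
    have "f ?z \<le> (1 - t) * f x + t * f y"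
    proof -
      consider "x > 0" | "y < 0" | "x \<le> 0" "y \<ge> 0" by linarith
      thus ?thesis
      proof cases
        case 1
        thus ?thesis using convex_onD[OF pos, of t x y] t xy by simp
      next
        case 2
        thus ?thesis using convex_onD[OF neg, of t x y] t xy by simp
      next
        case 3
        show ?thesis
        proof (cases "?z \<ge> 0")
          case True
          have "y > 0"
          proof (rule ccontr)
            assume "\<not> y > 0"
            hence "y = 0" "x < 0" using 3 xy by auto
            thus False using True t by (simp add: zero_le_mult_iff)
          qed
          thus ?thesis using glue[OF pos D tangent] t 3 True by simp
        next
          case False
          have "x < 0"
          proof (rule ccontr)
            assume "\<not> x < 0"
            hence "x = 0" "y > 0" using 3 xy by auto
            thus False using False t by simp
          qed
          \<comment> \<open>Reflection at 0 exchanges the endpoints, hence also the weights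
            \<open>t\<close> and \<open>1 - t\<close>.\<close>
          have "f (- ((1 - (1 - t)) * (- y) + (1 - t) * (- x))) \<le> (1 - (1 - t)) * f (- (- y)) + (1 - t) * f (- (- x))"
            by (rule glue[OF neg' D']) (use t 3 \<open>x < 0\<close> False tangent[of y] in auto)
          thus ?thesis by (simp add: algebra_simps)
        qed
      qed
    qed
    thus "f ((1 - t) *\<^sub>R x + t *\<^sub>R y) \<le> (1 - t) * f x + t * f y" by simp
  qed simp
qed

section \<open>Differentiability at 0\<close>

lemma exp_cubic_remainder: "\<bar>exp x - 1 - x - x\<^sup>2 / 2\<bar> \<le> exp \<bar>x\<bar> * \<bar>x\<bar> ^ 3" for x :: real
proof -
  obtain t where t: "\<bar>t\<bar> \<le> \<bar>x\<bar>" "exp x = (\<Sum>m<3. x ^ m / fact m) + exp t / fact 3 * x ^ 3"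
    using Maclaurin_exp_le[of x 3] by blast
  have "exp x - 1 - x - x\<^sup>2 / 2 = exp t / 6 * x ^ 3"
    using t(2) by (simp add: eval_nat_numeral)
  also have "\<bar>\<dots>\<bar> = exp t * \<bar>x\<bar> ^ 3 / 6" by (simp add: abs_mult power_abs)
  also have "\<dots> \<le> exp t * \<bar>x\<bar> ^ 3" by simp
  also have "\<dots> \<le> exp \<bar>x\<bar> * \<bar>x\<bar> ^ 3" using t(1) by (intro mult_right_mono) auto
  finally show ?thesis .
qed

context prob_space
begin

lemma integrable_exp_abs:
  fixes X :: "'a \<Rightarrow> real"
  assumes "\<And>l. integrable M (\<lambda>\<omega>. exp (l * X \<omega>))" and [measurable]: "X \<in> borel_measurable M"
  shows "integrable M (\<lambda>\<omega>. exp (k * \<bar>X \<omega>\<bar>))"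
proof (rule Bochner_Integration.integrable_bound)
  show "integrable M (\<lambda>\<omega>. exp (k * X \<omega>) + exp (- k * X \<omega>))"
    by (intro Bochner_Integration.integrable_add assms)
  have "exp (k * \<bar>x\<bar>) \<le> exp (k * x) + exp (- k * x)" for x :: real by (cases "x \<ge> 0") auto
  thus "AE \<omega> in M. norm (exp (k * \<bar>X \<omega>\<bar>)) \<le> norm (exp (k * X \<omega>) + exp (- k * X \<omega>))"
    by (intro AE_I2) (simp add: add_pos_pos)
qed measurable

text \<open>Centering subtracts the value at 0 exactly, so the difference quotient is
  \<open>ln (\<psi> h) / h^2\<close> for the centered variable \<open>Y\<close>. There the
  first-order term vanishes and \<open>\<psi> h = 1 + h^2 * V / 2\<close> up to a cubic
  error.\<close>

lemma normalized_cgf_DERIV_0: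
  fixes X :: "'a \<Rightarrow> real"
  assumes int: "\<And>l. integrable M (\<lambda>\<omega>. exp (l * X \<omega>))" and X [measurable]: "X \<in> borel_measurable M"
  shows "\<exists>c. (normalized_cgf X has_real_derivative c) (at 0)"
proof -
  have intabs: "integrable M (\<lambda>\<omega>. exp (k * \<bar>X \<omega>\<bar>))" for k by (rule integrable_exp_abs[OF int X])
  have intX: "integrable M X"
  proof (rule Bochner_Integration.integrable_bound[OF intabs[of 1]])
    have "\<bar>x\<bar> \<le> exp \<bar>x\<bar>" for x :: real using exp_ge_add_one_self[of "\<bar>x\<bar>"] by linarith
    thus "AE \<omega> in M. norm (X \<omega>) \<le> norm (exp (1 * \<bar>X \<omega>\<bar>))" by (intro AE_I2) simp
  qed measurable
  define m where "m = expectation X"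
  define Y where "Y \<omega> = X \<omega> - m" for \<omega>
  have [measurable]: "Y \<in> borel_measurable M" unfolding Y_def by measurable
  have intY: "integrable M (\<lambda>\<omega>. exp (l * Y \<omega>))" for l
    using integrable_mult_right[OF int[of l], of "exp (- l * m)"] by (simp add: Y_def exp_add[symmetric] algebra_simps)
  have intYabs: "integrable M (\<lambda>\<omega>. exp (k * \<bar>Y \<omega>\<bar>))" for k by (rule integrable_exp_abs[OF intY]) measurable
  \<comment> \<open>A single term of the exponential series is at most its sum.\<close>
  have pow: "y ^ n \<le> fact n * exp y" if "y \<ge> 0" for y :: real and n
  proof -
    have "(\<Sum>i\<in>{n}. y ^ i /\<^sub>R fact i) \<le> exp y"
      unfolding exp_def using that by (intro sum_le_suminf summable_exp_generic) auto
    hence "y ^ n / fact n \<le> exp y" by (simp add: divide_inverse mult.commute)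
    thus ?thesis by (simp add: pos_divide_le_eq mult.commute)
  qed
  have int3: "integrable M (\<lambda>\<omega>. exp \<bar>Y \<omega>\<bar> * \<bar>Y \<omega>\<bar> ^ 3)"
  proof (rule Bochner_Integration.integrable_bound)
    show "integrable M (\<lambda>\<omega>. 6 * exp (2 * \<bar>Y \<omega>\<bar>))" by (intro integrable_mult_right intYabs)
    have "exp y * y ^ 3 \<le> 6 * exp (2 * y)" if "y \<ge> 0" for y :: real
    proof -
      have "exp y * y ^ 3 \<le> exp y * (fact 3 * exp y)" by (intro mult_left_mono pow that) simp
      also have "\<dots> = 6 * exp (2 * y)" by (simp add: fact_numeral exp_double power2_eq_square)
      finally show ?thesis .
    qed
    thus "AE \<omega> in M. norm (exp \<bar>Y \<omega>\<bar> * \<bar>Y \<omega>\<bar> ^ 3) \<le> norm (6 * exp (2 * \<bar>Y \<omega>\<bar>))"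
      by (intro AE_I2) (simp add: abs_mult)
  qed measurable
  have int2: "integrable M (\<lambda>\<omega>. (Y \<omega>)\<^sup>2)"
  proof (rule Bochner_Integration.integrable_bound)
    show "integrable M (\<lambda>\<omega>. 2 * exp (1 * \<bar>Y \<omega>\<bar>))" by (intro integrable_mult_right intYabs)
    have "y\<^sup>2 \<le> 2 * exp \<bar>y\<bar>" for y :: real using pow[of "\<bar>y\<bar>" 2] by simp
    thus "AE \<omega> in M. norm ((Y \<omega>)\<^sup>2) \<le> norm (2 * exp (1 * \<bar>Y \<omega>\<bar>))"
      by (intro AE_I2) simp
  qed measurable
  have int1: "integrable M Y" "expectation Y = 0" using intX by (simp_all add: Y_def[abs_def] m_def prob_space)
  define \<psi> where "\<psi> h = expectation (\<lambda>\<omega>. exp (h * Y \<omega>))" for h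
  define C where "C = expectation (\<lambda>\<omega>. exp \<bar>Y \<omega>\<bar> * \<bar>Y \<omega>\<bar> ^ 3)"
  define V where "V = expectation (\<lambda>\<omega>. (Y \<omega>)\<^sup>2)"
  have C: "C \<ge> 0" and V: "V \<ge> 0" by (auto simp: C_def V_def intro!: integral_nonneg_AE)
  have taylor: "\<bar>\<psi> h - 1 - h\<^sup>2 * V / 2\<bar> \<le> \<bar>h\<bar> ^ 3 * C" if h: "\<bar>h\<bar> \<le> 1" for h
  proof -
    let ?r = "\<lambda>\<omega>. exp (h * Y \<omega>) - 1 - h * Y \<omega> - h\<^sup>2 / 2 * (Y \<omega>)\<^sup>2"
    have intr: "integrable M ?r"
      by (intro Bochner_Integration.integrable_diff intY integrable_mult_right int1 int2 integrable_const)
    have eq: "\<psi> h - 1 - h\<^sup>2 * V / 2 = expectation ?r"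
      using intY int1 int2 by (simp add: \<psi>_def V_def prob_space)
    have "\<bar>\<psi> h - 1 - h\<^sup>2 * V / 2\<bar> \<le> expectation (\<lambda>\<omega>. \<bar>?r \<omega>\<bar>)"
      unfolding eq by (rule integral_abs_bound)
    also have "\<dots> \<le> expectation (\<lambda>\<omega>. \<bar>h\<bar> ^ 3 * (exp \<bar>Y \<omega>\<bar> * \<bar>Y \<omega>\<bar> ^ 3))"
    proof (rule integral_mono)
      fix \<omega>
      have "h\<^sup>2 / 2 * (Y \<omega>)\<^sup>2 = (h * Y \<omega>)\<^sup>2 / 2" unfolding power_mult_distrib by simp
      hence "\<bar>?r \<omega>\<bar> \<le> exp \<bar>h * Y \<omega>\<bar> * \<bar>h * Y \<omega>\<bar> ^ 3"
        by (simp only: exp_cubic_remainder)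
      also have "\<dots> \<le> exp \<bar>Y \<omega>\<bar> * \<bar>h * Y \<omega>\<bar> ^ 3"
      proof (rule mult_right_mono)
        show "exp \<bar>h * Y \<omega>\<bar> \<le> exp \<bar>Y \<omega>\<bar>"
          using mult_right_mono[OF h, of "\<bar>Y \<omega>\<bar>"] unfolding abs_mult by simp
      qed simp
      also have "\<dots> = \<bar>h\<bar> ^ 3 * (exp \<bar>Y \<omega>\<bar> * \<bar>Y \<omega>\<bar> ^ 3)"
        unfolding abs_mult power_mult_distrib by (rule mult.left_commute)
      finally show "\<bar>?r \<omega>\<bar> \<le> \<bar>h\<bar> ^ 3 * (exp \<bar>Y \<omega>\<bar> * \<bar>Y \<omega>\<bar> ^ 3)" .
    qed (use intr int3 in auto)
    finally show ?thesis by (simp add: C_def)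
  qed
  \<comment> \<open>Chosen so that the distance of \<open>\<psi> h\<close> from 1 is at most
    \<open>h\<^sup>2 * A\<close> for \<open>\<bar>h\<bar> \<le> 1\<close>; once this is at most 1/2,
    the second-order bound on the logarithm applies.\<close>
  define A where "A = V / 2 + C"
  have bound: "\<bar>ln (\<psi> h) / h\<^sup>2 - V / 2\<bar> \<le> \<bar>h\<bar> * C + 2 * h\<^sup>2 * A\<^sup>2"
    if h: "\<bar>h\<bar> \<le> 1" "h\<^sup>2 * A \<le> 1 / 2" "h \<noteq> 0" for h
  proof -
    define x where "x = \<psi> h - 1"
    have h3: "\<bar>h\<bar> ^ 3 = \<bar>h\<bar> * h\<^sup>2" by (simp add: power3_eq_cube power2_eq_square abs_mult_self_eq mult.assoc)
    have "\<bar>h\<bar> ^ 3 * C \<le> h\<^sup>2 * C" unfolding h3 using h(1) C by (intro mult_right_mono) (auto simp: mult_left_le_one_le)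
    have xA: "\<bar>x\<bar> \<le> h\<^sup>2 * A"
    proof -
      have "0 \<le> h\<^sup>2 * V / 2" using V by simp
      moreover have "h\<^sup>2 * A = h\<^sup>2 * V / 2 + h\<^sup>2 * C" by (simp add: A_def algebra_simps)
      ultimately show ?thesis
        using taylor[OF h(1)] \<open>\<bar>h\<bar> ^ 3 * C \<le> h\<^sup>2 * C\<close> unfolding x_def by linarith
    qed
    hence "\<bar>ln (1 + x) - x\<bar> \<le> 2 * x\<^sup>2" using h(2) by (intro abs_ln_one_plus_x_minus_x_bound) linarith
    also have "\<dots> \<le> 2 * (h\<^sup>2 * A)\<^sup>2" using power_mono[OF xA, of 2] by simp
    finally have "\<bar>ln (\<psi> h) - h\<^sup>2 * V / 2\<bar> \<le> \<bar>h\<bar> ^ 3 * C + 2 * (h\<^sup>2 * A)\<^sup>2"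
      using taylor[OF h(1)] by (simp add: x_def)
    also have "\<dots> = h\<^sup>2 * (\<bar>h\<bar> * C + 2 * h\<^sup>2 * A\<^sup>2)"
      unfolding h3 by (simp add: power2_eq_square algebra_simps)
    also have "\<bar>ln (\<psi> h) - h\<^sup>2 * V / 2\<bar> = h\<^sup>2 * \<bar>ln (\<psi> h) / h\<^sup>2 - V / 2\<bar>"
    proof -
      have "ln (\<psi> h) - h\<^sup>2 * V / 2 = h\<^sup>2 * (ln (\<psi> h) / h\<^sup>2 - V / 2)" using h(3) by (simp add: field_simps)
      thus ?thesis by (simp add: abs_mult)
    qed
    finally show ?thesis using h(3) by simp
  qed
  have "((\<lambda>h. ln (\<psi> h) / h\<^sup>2) \<longlongrightarrow> V / 2) (at 0)"
  proof (rule LIM_zero_cancel, rule Lim_null_comparison)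
    have ev: "\<forall>\<^sub>F h :: real in at 0. \<bar>h\<bar> < 1" "\<forall>\<^sub>F h in at 0. h\<^sup>2 * A < 1 / 2"
    proof -
      have "((\<lambda>h::real. \<bar>h\<bar>) \<longlongrightarrow> 0) (at 0)" by (auto intro!: tendsto_eq_intros)
      thus "\<forall>\<^sub>F h :: real in at 0. \<bar>h\<bar> < 1" by (rule order_tendstoD(2)) simp
      have "((\<lambda>h::real. h\<^sup>2 * A) \<longlongrightarrow> 0) (at 0)" by (auto intro!: tendsto_eq_intros)
      thus "\<forall>\<^sub>F h in at 0. h\<^sup>2 * A < 1 / 2" by (rule order_tendstoD(2)) simp
    qed
    have "\<forall>\<^sub>F h :: real in at 0. h \<noteq> 0" by (rule eventually_neq_at_within)
    with ev show "\<forall>\<^sub>F h in at 0. norm (ln (\<psi> h) / h\<^sup>2 - V / 2) \<le> \<bar>h\<bar> * C + 2 * h\<^sup>2 * A\<^sup>2"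
      by eventually_elim (use bound in auto)
    show "((\<lambda>h. \<bar>h\<bar> * C + 2 * h\<^sup>2 * A\<^sup>2) \<longlongrightarrow> 0) (at 0)" by (auto intro!: tendsto_eq_intros)
  qed
  moreover have "(normalized_cgf X h - normalized_cgf X 0) / h = ln (\<psi> h) / h\<^sup>2" if h: "h \<noteq> 0" for h
  proof -
    have "expectation (\<lambda>\<omega>. exp (h * X \<omega>)) = expectation (\<lambda>\<omega>. exp (h * m) * exp (h * Y \<omega>))"
      by (simp add: Y_def exp_add[symmetric] algebra_simps)
    also have "\<dots> = exp (h * m) * \<psi> h" by (simp add: \<psi>_def)
    finally have "ln (expectation (\<lambda>\<omega>. exp (h * X \<omega>))) = h * m + ln (\<psi> h)"
      using expectation_exp_pos[OF intY, of h] by (simp add: ln_mult_pos \<psi>_def)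
    thus ?thesis using h by (simp add: normalized_cgf_def m_def field_simps power2_eq_square)
  qed
  ultimately have "((\<lambda>h. (normalized_cgf X (0 + h) - normalized_cgf X 0) / h) \<longlongrightarrow> V / 2) (at 0)"
    by (subst tendsto_cong[of _ "\<lambda>h. ln (\<psi> h) / h\<^sup>2"]) (auto simp: eventually_at_filter)
  thus ?thesis by (auto simp: DERIV_def)
qed

end

section \<open>Transfer to the given probability space\<close>

theorem theorem1:
  fixes M :: "'a measure" and g :: "'a \<Rightarrow> real ^ 'n" and F :: "real ^ 'n \<Rightarrow> real"
  assumes "prob_space M"
    and "prob_space.standard_gaussian_vector M g"
    and "convex_on UNIV F"
    and "\<And>l::real. l > 0 \<Longrightarrow> integrable M (\<lambda>\<omega>. exp (l * F (g \<omega>)))"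
  shows "convex_on UNIV (prob_space.normalized_cgf M (\<lambda>\<omega>. F (g \<omega>)))"
proof -
  interpret prob_space M by fact
  let ?P = "gaussian_product (UNIV :: 'n set)"
  have indep: "indep_vars (\<lambda>_. borel) (\<lambda>i \<omega>. g \<omega> $ i) UNIV"
    and distr: "\<And>i. distributed M lborel (\<lambda>\<omega>. g \<omega> $ i) std_normal_density"
    using assms(2) by (auto simp: standard_gaussian_vector_def)
  have rv: "random_variable borel (\<lambda>\<omega>. g \<omega> $ i)" for i
    using distributed_measurable[OF distr[of i]] by simp
  define T where "T \<omega> = (\<lambda>i\<in>UNIV. g \<omega> $ i)" for \<omega>
  have T: "T \<in> measurable M (PiM UNIV (\<lambda>_. borel))"
    unfolding T_def by (intro measurable_restrict rv)
  \<comment> \<open>Independence says that the joint law of the coordinates is the product of their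
    laws, each of which is standard normal.\<close>
  have "distr M (PiM UNIV (\<lambda>_. borel)) T = PiM UNIV (\<lambda>i. distr M borel (\<lambda>\<omega>. g \<omega> $ i))"
    using indep unfolding T_def by (subst (asm) indep_vars_iff_distr_eq_PiM[OF _ rv]) auto
  also have "\<dots> = ?P"
  proof -
    have "distr M borel (\<lambda>\<omega>. g \<omega> $ i) = distr M lborel (\<lambda>\<omega>. g \<omega> $ i)" for i
      by (intro distr_cong) auto
    thus ?thesis using distributed_distr_eq_density[OF distr] by simp
  qed
  finally have P: "distr M (PiM UNIV (\<lambda>_. borel)) T = ?P" .
  have cT: "coords UNIV (T \<omega>) = g \<omega>" for \<omega> by (simp add: coords_def T_def vec_eq_iff)
  have F [measurable]: "F \<in> borel_measurable borel"
    using convex_on_continuous[OF open_UNIV assms(3)] by (rule borel_measurable_continuous_onI)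
  have c: "(\<lambda>w. F (coords UNIV w)) \<in> borel_measurable ?P" by measurable
  hence c': "(\<lambda>w. F (coords UNIV w)) \<in> borel_measurable (PiM UNIV (\<lambda>_. borel))"
    by (simp cong: measurable_cong_sets sets_PiM_cong)
  have X [measurable]: "(\<lambda>\<omega>. F (g \<omega>)) \<in> borel_measurable M"
    using measurable_compose[OF T c'] by (simp add: cT)
  have e: "(\<lambda>w. exp (l * F (coords UNIV w))) \<in> borel_measurable (PiM UNIV (\<lambda>_. borel))" for l
    using c' by measurable
  have int_iff: "integrable ?P (\<lambda>w. exp (l * F (coords UNIV w))) \<longleftrightarrow> integrable M (\<lambda>\<omega>. exp (l * F (g \<omega>)))" for l
    unfolding P[symmetric] by (simp add: integrable_distr_eq[OF T e] cT)
  have E: "(\<integral>w. exp (l * F (coords UNIV w)) \<partial>?P) = expectation (\<lambda>\<omega>. exp (l * F (g \<omega>)))" for l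
    unfolding P[symmetric] by (simp add: integral_distr[OF T e] cT)
  have int0: "integrable ?P (\<lambda>w. exp (l * F (coords UNIV w)))" if "l > 0" for l
    using assms(4)[OF that] by (simp add: int_iff)
  have int: "integrable M (\<lambda>\<omega>. exp (l * F (g \<omega>)))" for l
    using gaussian_cgf_convex_halves(1)[OF assms(3) int0, of l] by (simp add: int_iff)
  have half: "convex_on \<Lambda> (normalized_cgf (\<lambda>\<omega>. F (g \<omega>)))" if \<Lambda>: "\<Lambda> = {0<..} \<or> \<Lambda> = {..<0}" for \<Lambda>
  \<comment> \<open>A constant sequence: the limit lemma replaces the function by one that agrees
    with it on \<open>\<Lambda>\<close>, where \<open>l = 0\<close> is excluded.\<close>
  proof (rule convex_on_limit)
    show "convex_on \<Lambda> (\<lambda>l. ln (expectation (\<lambda>\<omega>. exp (l * F (g \<omega>)))) / l)"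
      using gaussian_cgf_convex_halves(2)[OF assms(3) int0 \<Lambda>] by (simp add: E)
    show "(\<lambda>n. ln (expectation (\<lambda>\<omega>. exp (l * F (g \<omega>)))) / l) \<longlonglongrightarrow> normalized_cgf (\<lambda>\<omega>. F (g \<omega>)) l" if "l \<in> \<Lambda>" for l
      using that \<Lambda> by (auto simp: normalized_cgf_def)
  qed
  obtain c where "(normalized_cgf (\<lambda>\<omega>. F (g \<omega>)) has_real_derivative c) (at 0)"
    using normalized_cgf_DERIV_0[OF int X] by blast
  thus ?thesis by (intro convex_on_glue_at_0 half) auto
qed

end
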